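(* Let $\mathcal{V}=(V_1,\ldots,V_n)$ be a list of linear subspaces of $\mathbb{R}^\ell$, each of dimension at most $k$, having an $(\alpha,\delta)$-system ($\alpha\in\mathbb{Z}^+$, $\delta>0$), and let $d=\dim(V_1+\cdots+V_n)$. Then for every $\beta\in(0,1)$ at least one of the following holds: (1) $d\leq 400\alpha k^3/(\beta\delta)$; (2) there are $q\geq\delta n/(20\alpha)$ distinct indices $i_1,\ldots,i_q\in[n]$ and nonzero vectors $\vec{z}_1\in V_{i_1},\ldots,\vec{z}_q\in V_{i_q}$ with $\dim(\mathrm{span}\{\vec{z}_1,\ldots,\vec{z}_q\})\leq\beta d$.
   Context: Given $\mathcal{V}=(V_1,\ldots,V_n)$, a list of sets $\mathcal{S}=(S_1,\ldots,S_w)$ is an $(\alpha,\delta)$-system of $\mathcal{V}$ if: (1) every $S_j$ is a subset of $[n]$ of size $3$ or $2$; (2) if $S_j=\{i_1,i_2,i_3\}$ then $V_{i_1}\subseteq V_{i_2}+V_{i_3}$, $V_{i_2}\subseteq V_{i_1}+V_{i_3}$, $V_{i_3}\subseteq V_{i_1}+V_{i_2}$; if $S_j=\{i_1,i_2\}$ then $V_{i_1}=V_{i_2}$; (3) every $i\in[n]$ lies in at least $\delta n$ sets of $\mathcal{S}$; (4) every pair $\{i_1,i_2\}$, $i_1\neq i_2$, lies together in at most $\alpha$ sets of $\mathcal{S}$. *)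

theory Defs
  imports "HOL-Analysis.Analysis" "HOL-Library.Set_Algebras"
begin

text \<open>
  The index set \<open>[n]\<close> is \<open>{1..n}\<close>; only the values \<open>V i\<close> with \<open>i \<in> {1..n}\<close> matter.
  \<open>S\<close> is a list, so repeated sets are counted with multiplicity: positions of \<open>S\<close> are counted,
  not elements of \<open>set S\<close>. Addition of subspaces is the elementwise sum of sets from
  \<open>Set_Algebras\<close>.
\<close>

definition ad_system ::
    "nat \<Rightarrow> real \<Rightarrow> nat \<Rightarrow> (nat \<Rightarrow> 'a::real_vector set) \<Rightarrow> nat set list \<Rightarrow> bool" where
  "ad_system \<alpha> \<delta> n V S \<longleftrightarrow>
     (\<forall>j<length S. S ! j \<subseteq> {1..n} \<and> (card (S ! j) = 3 \<or> card (S ! j) = 2)) \<and>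
     (\<forall>j<length S. \<forall>i1 i2 i3. distinct [i1, i2, i3] \<and> S ! j = {i1, i2, i3} \<longrightarrow>
        V i1 \<subseteq> V i2 + V i3 \<and> V i2 \<subseteq> V i1 + V i3 \<and> V i3 \<subseteq> V i1 + V i2) \<and>
     (\<forall>j<length S. \<forall>i1 i2. i1 \<noteq> i2 \<and> S ! j = {i1, i2} \<longrightarrow> V i1 = V i2) \<and>
     (\<forall>i\<in>{1..n}. real (card {j. j < length S \<and> i \<in> S ! j}) \<ge> \<delta> * real n) \<and>
     (\<forall>i1\<in>{1..n}. \<forall>i2\<in>{1..n}. i1 \<noteq> i2 \<longrightarrow>
        card {j. j < length S \<and> {i1, i2} \<subseteq> S ! j} \<le> \<alpha>)"

end

theory Submission
  imports Defs
begin

text \<open>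
  For a weight \<open>\<tau>\<close> with \<open>\<tau> n k = \<beta> d\<close>, let \<open>W\<close> maximise \<open>\<tau> (\<Sum>i. dim (V i \<inter> W)) - dim W\<close>;
  then \<open>dim W \<le> \<beta> d\<close>.
  If \<open>W\<close> meets many of the \<open>V i\<close> nontrivially, the second alternative holds. Otherwise discard these
  few indices; by supermodularity the remaining spaces satisfy \<open>\<tau> (\<Sum>i. dim (V i \<inter> W')) \<le> dim W'\<close>
  for every subspace \<open>W'\<close>. Under this condition there is an inner product whose orthogonal
  projections \<open>Q i\<close> onto \<open>V i\<close> satisfy \<open>\<tau> (\<Sum>i. Q i) \<le> 2\<close>, a subspace version of a theorem of
  Barthe. So for each \<open>i\<close> at most \<open>18 k / \<tau>\<close> of the \<open>V j\<close> make a small angle with \<open>V i\<close>. But a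
  dependent triple always contains two spaces at a small angle, and counting such pairs bounds \<open>d\<close>.

  The inner product comes from a nonlinear Perron-Frobenius argument. Let \<open>S i Z\<close> be the largest
  positive semidefinite matrix below \<open>Z\<close> with range in \<open>V i\<close>. Brouwer's theorem, applied to a
  regularisation of \<open>Z \<mapsto> \<tau> (\<Sum>i. S i Z)\<close> on density matrices, gives positive definite \<open>Z\<close> with
  \<open>\<tau> (\<Sum>i. S i Z) \<le> t Z\<close>. As the regularisation vanishes, the eigenvalue \<open>t\<close> has a limit at most 1:
  taking traces relative to the limit of \<open>Z\<close>, whose range is \<open>W'\<close> say, gives
  \<open>t dim W' \<le> \<tau> (\<Sum>i. dim (V i \<inter> W'))\<close>. The inner product is given by the inverse of \<open>Z\<close>.
\<close>

section \<open>Positive semidefinite forms\<close>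

definition psd :: "real^'n^'n \<Rightarrow> bool" where
  "psd A \<longleftrightarrow> transpose A = A \<and> (\<forall>x. 0 \<le> x \<bullet> (A *v x))"

lemma inner_matrix_vector_transpose: "x \<bullet> (A *v y) = (transpose A *v x) \<bullet> y"
  for A :: "real^'n^'m"
  by (metis dot_lmul_matrix transpose_matrix_vector)

lemma psd_nonneg: "psd A \<Longrightarrow> 0 \<le> x \<bullet> (A *v x)"
  by (simp add: psd_def)

lemma psd_symmetric: "psd A \<Longrightarrow> x \<bullet> (A *v y) = y \<bullet> (A *v x)"
  by (metis inner_commute inner_matrix_vector_transpose psd_def)

text \<open>The form at \<open>x - s *\<^sub>R y\<close> is a nonnegative quadratic in
  \<open>s\<close>, so its discriminant is not positive. The form may be degenerate, so a vanishing
  leading coefficient is treated separately.\<close>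

lemma psd_Cauchy_Schwarz:
  assumes "psd A"
  shows "(x \<bullet> (A *v y))\<^sup>2 \<le> (x \<bullet> (A *v x)) * (y \<bullet> (A *v y))"
proof -
  define a b c where "a = y \<bullet> (A *v y)" and "b = x \<bullet> (A *v y)" and "c = x \<bullet> (A *v x)"
  have "(x - s *\<^sub>R y) \<bullet> (A *v (x - s *\<^sub>R y)) = c - 2 * s * b + s\<^sup>2 * a" for s
    using psd_symmetric[OF assms, of y x]
    by (simp add: a_def b_def c_def algebra_simps inner_diff_left inner_diff_right
        matrix_vector_mult_diff_distrib matrix_vector_mult_scaleR power2_eq_square)
  then have quadratic_nonneg: "0 \<le> c - 2 * s * b + s\<^sup>2 * a" for s
    using psd_nonneg[OF assms, of "x - s *\<^sub>R y"] by simp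
  have "a \<ge> 0" "c \<ge> 0"
    using assms by (simp_all add: a_def c_def psd_nonneg)
  have "b\<^sup>2 \<le> c * a"
  proof (cases "a = 0")
    case True
    have "b = 0"
    proof (rule ccontr)
      assume "b \<noteq> 0"
      \<comment> \<open>At this value of \<open>s\<close> the remaining affine function equals
        -1.\<close>
      with quadratic_nonneg[of "(c + 1) / (2 * b)"] True show False by simp
    qed
    with True show ?thesis by simp
  next
    case False
    with \<open>a \<ge> 0\<close> have "a > 0" by simp
    with quadratic_nonneg[of "b / a"] have "0 \<le> c - b\<^sup>2 / a"
      by (simp add: power2_eq_square field_simps)
    with \<open>a > 0\<close> show ?thesis by (simp add: field_simps)
  qed
  then show ?thesis by (simp add: a_def b_def c_def)
qed

lemma psd_kernel:
  assumes "psd A" "x \<bullet> (A *v x) = 0"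
  shows "A *v x = 0"
  using psd_Cauchy_Schwarz[OF assms(1), of "A *v x" x] assms(2) by simp

text \<open>Pairing a vanishing combination of the \<open>f c\<close> with \<open>g b\<close>
  isolates one coefficient. Two families are allowed because orthonormality for a form
  \<open>A\<close> is biorthogonality of the vectors \<open>b\<close> and
  \<open>A *v b\<close>.\<close>

lemma biorthogonal_independent:
  fixes f g :: "'b \<Rightarrow> 'a::euclidean_space"
  assumes "finite B" and "\<And>b c. b \<in> B \<Longrightarrow> c \<in> B \<Longrightarrow> g b \<bullet> f c = (if b = c then 1 else 0)"
  shows "inj_on f B" and "independent (f ` B)"
proof -
  show inj: "inj_on f B"
    by (rule inj_onI) (metis assms(2) zero_neq_one)
  have "u v = 0" if "(\<Sum>v\<in>f ` B. u v *\<^sub>R v) = 0" "v \<in> f ` B" for u v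
  proof -
    obtain b where b: "b \<in> B" "v = f b" using \<open>v \<in> f ` B\<close> by auto
    have "0 = g b \<bullet> (\<Sum>v\<in>f ` B. u v *\<^sub>R v)" using that(1) by simp
    also have "\<dots> = (\<Sum>c\<in>B. u (f c) * (g b \<bullet> f c))"
      by (simp add: sum.reindex[OF inj] inner_sum_right)
    also have "\<dots> = (\<Sum>c\<in>B. if c = b then u (f b) else 0)"
      using assms(2) b by (intro sum.cong) auto
    also have "\<dots> = u v" using b assms(1) by simp
    finally show ?thesis by simp
  qed
  then show "independent (f ` B)"
    using assms(1) by (subst dependent_finite) auto
qed

text \<open>\<open>B\<close> is an \<open>A\<close>-orthonormal subset of \<open>U\<close> of
  maximal size. Subtracting from \<open>x\<close> its expansion leaves a vector \<open>r\<close>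
  orthogonal to \<open>B\<close>; if its form value were positive, \<open>r\<close> could be
  normalised and added to \<open>B\<close>, so \<open>A *v r = 0\<close>. As \<open>A\<close> may be
  singular, \<open>B\<close> spans \<open>U\<close> only up to the kernel of \<open>A\<close>, which
  the expansion under the form does not see.\<close>

lemma psd_orthonormal_basis:
  fixes A :: "real^'n^'n"
  assumes A: "psd A" and U: "subspace U"
  obtains B where "finite B" "B \<subseteq> U" "card B \<le> dim U"
    "\<And>b c. b \<in> B \<Longrightarrow> c \<in> B \<Longrightarrow> b \<bullet> (A *v c) = (if b = c then 1 else 0)"
    "\<And>x y. x \<in> U \<Longrightarrow> x \<bullet> (A *v y) = (\<Sum>b\<in>B. (x \<bullet> (A *v b)) * (b \<bullet> (A *v y)))"
proof -
  define orth where "orth B \<longleftrightarrow> finite B \<and> B \<subseteq> U \<and>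
    (\<forall>b\<in>B. \<forall>c\<in>B. b \<bullet> (A *v c) = (if b = c then 1 else 0))" for B
  have card_le: "card B \<le> dim U" if "orth B" for B
  proof -
    have "independent ((\<lambda>b. b) ` B)"
      using that psd_symmetric[OF A]
      by (intro biorthogonal_independent[where g = "\<lambda>b. A *v b"])
         (auto simp: orth_def inner_commute)
    with that show ?thesis
      by (metis image_ident independent_card_le_dim orth_def)
  qed
  have "orth {}" by (simp add: orth_def)
  then obtain B where B: "orth B" and max: "\<And>C. orth C \<Longrightarrow> card C \<le> card B"
    using ex_has_greatest_nat[of orth "{}" card "Suc (dim U)"] card_le
    by (metis le_imp_less_Suc)
  have fin: "finite B" and sub: "B \<subseteq> U"
    and orthB: "\<And>b c. b \<in> B \<Longrightarrow> c \<in> B \<Longrightarrow> b \<bullet> (A *v c) = (if b = c then 1 else 0)"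
    using B by (auto simp: orth_def)
  have "x \<bullet> (A *v y) = (\<Sum>b\<in>B. (x \<bullet> (A *v b)) * (b \<bullet> (A *v y)))" if "x \<in> U" for x y
  proof -
    define r where "r = x - (\<Sum>b\<in>B. (x \<bullet> (A *v b)) *\<^sub>R b)"
    have rU: "r \<in> U"
      unfolding r_def using U sub \<open>x \<in> U\<close>
      by (intro subspace_diff subspace_sum subspace_mul) auto
    have r_orth: "r \<bullet> (A *v c) = 0" if "c \<in> B" for c
    proof -
      have "r \<bullet> (A *v c) = x \<bullet> (A *v c) - (\<Sum>b\<in>B. (x \<bullet> (A *v b)) * (b \<bullet> (A *v c)))"
        by (simp add: r_def inner_diff_left inner_sum_left)
      also have "(\<Sum>b\<in>B. (x \<bullet> (A *v b)) * (b \<bullet> (A *v c))) =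
          (\<Sum>b\<in>B. if b = c then x \<bullet> (A *v c) else 0)"
        using orthB that by (intro sum.cong) auto
      also have "\<dots> = x \<bullet> (A *v c)" using fin that by simp
      finally show ?thesis by simp
    qed
    have "r \<bullet> (A *v r) = 0"
    proof (rule ccontr)
      assume "r \<bullet> (A *v r) \<noteq> 0"
      then have pos: "r \<bullet> (A *v r) > 0" using psd_nonneg[OF A, of r] by simp
      define e where "e = (1 / sqrt (r \<bullet> (A *v r))) *\<^sub>R r"
      have ee: "e \<bullet> (A *v e) = 1"
        using pos by (simp add: e_def matrix_vector_mult_scaleR field_simps)
      have eB: "e \<bullet> (A *v c) = 0" "c \<bullet> (A *v e) = 0" if "c \<in> B" for c
        using r_orth[OF that] psd_symmetric[OF A, of c e] by (simp_all add: e_def)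
      have "e \<notin> B" using eB(1) ee by fastforce
      have "e \<in> U" using rU U by (simp add: e_def subspace_mul)
      have "orth (insert e B)"
        unfolding orth_def using fin sub \<open>e \<in> U\<close> ee eB orthB \<open>e \<notin> B\<close> by auto
      from max[OF this] show False using \<open>e \<notin> B\<close> fin by simp
    qed
    then have "A *v r = 0" by (rule psd_kernel[OF A])
    then have "r \<bullet> (A *v y) = 0" using psd_symmetric[OF A, of r y] by simp
    then show ?thesis by (simp add: r_def inner_diff_left inner_sum_left)
  qed
  with that[OF fin sub card_le[OF B] orthB] show ?thesis by blast
qed

text \<open>The left side is the trace of \<open>A\<close> relative to \<open>Y\<close>. An
  \<open>A\<close>-orthonormal \<open>C\<close> splits \<open>A\<close> into rank one forms given by
  the vectors \<open>A *v c\<close>. These are independent vectors of \<open>U\<close>, so there are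
  at most \<open>dim U\<close> of them, and each contributes at most 1 because \<open>A\<close> lies
  below \<open>Y\<close>.\<close>

lemma psd_relative_trace_le:
  fixes A Y :: "real^'n^'n"
  assumes A: "psd A" and AY: "\<And>x. x \<bullet> (A *v x) \<le> x \<bullet> (Y *v x)"
    and fin: "finite B"
    and orthB: "\<And>b c. b \<in> B \<Longrightarrow> c \<in> B \<Longrightarrow> b \<bullet> (Y *v c) = (if b = c then 1 else 0)"
    and range: "range ((*v) A) \<subseteq> U"
  shows "(\<Sum>b\<in>B. b \<bullet> (A *v b)) \<le> real (dim U)"
proof -
  obtain C where C: "finite C"
    "\<And>b c. b \<in> C \<Longrightarrow> c \<in> C \<Longrightarrow> b \<bullet> (A *v c) = (if b = c then 1 else 0)"
    "\<And>x y. x \<in> UNIV \<Longrightarrow> x \<bullet> (A *v y) = (\<Sum>c\<in>C. (x \<bullet> (A *v c)) * (c \<bullet> (A *v y)))"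
    by (rule psd_orthonormal_basis[OF A subspace_UNIV]) blast
  have "card C \<le> dim U"
  proof -
    note indep = biorthogonal_independent[where g = "\<lambda>b. b" and f = "(*v) A", OF C(1,2)]
    have "card ((*v) A ` C) \<le> dim U"
      using range indep(2) by (intro independent_card_le_dim) auto
    then show ?thesis using card_image[OF indep(1)] by simp
  qed
  have le_one: "(\<Sum>b\<in>B. (b \<bullet> (A *v c))\<^sup>2) \<le> 1" if "c \<in> C" for c
  proof -
    \<comment> \<open>Cauchy-Schwarz for \<open>A\<close> at \<open>w\<close> and \<open>c\<close>
      bounds \<open>s\<^sup>2\<close> by the \<open>A\<close>-form of \<open>w\<close>, hence by its
      \<open>Y\<close>-form, which is \<open>s\<close> again; so \<open>s \<le> 1\<close>.\<close>
    define s where "s = (\<Sum>b\<in>B. (b \<bullet> (A *v c))\<^sup>2)"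
    define w where "w = (\<Sum>b\<in>B. (b \<bullet> (A *v c)) *\<^sub>R b)"
    have wA: "w \<bullet> (A *v c) = s"
      by (simp add: w_def s_def inner_sum_left power2_eq_square)
    have "Y *v w = (\<Sum>b\<in>B. (b \<bullet> (A *v c)) *\<^sub>R (Y *v b))"
      by (simp add: w_def linear_sum[OF matrix_vector_mul_linear] matrix_vector_mult_scaleR)
    then have "w \<bullet> (Y *v w) = (\<Sum>b\<in>B. \<Sum>b'\<in>B. (b \<bullet> (A *v c)) * (b' \<bullet> (A *v c)) * (b' \<bullet> (Y *v b)))"
      by (simp add: w_def inner_sum_left inner_sum_right sum_distrib_left mult_ac)
    also have "\<dots> = (\<Sum>b\<in>B. \<Sum>b'\<in>B. if b' = b then (b \<bullet> (A *v c))\<^sup>2 else 0)"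
      using orthB by (intro sum.cong) (auto simp: power2_eq_square)
    also have "\<dots> = s" using fin by (simp add: s_def)
    finally have "w \<bullet> (Y *v w) = s" .
    moreover have "s\<^sup>2 \<le> w \<bullet> (A *v w)"
      using psd_Cauchy_Schwarz[OF A, of w c] C(2)[OF that that] by (simp add: wA)
    ultimately have "s * s \<le> s" using AY[of w] by (simp add: power2_eq_square)
    moreover have "0 \<le> s" by (simp add: s_def sum_nonneg)
    ultimately have "s \<le> 1" by (cases "s = 0") (auto simp: mult_le_cancel_left1)
    then show ?thesis by (simp add: s_def)
  qed
  have "(\<Sum>b\<in>B. b \<bullet> (A *v b)) = (\<Sum>b\<in>B. \<Sum>c\<in>C. (b \<bullet> (A *v c))\<^sup>2)"
  proof (intro sum.cong refl)
    fix b assume "b \<in> B"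
    have "b \<bullet> (A *v b) = (\<Sum>c\<in>C. (b \<bullet> (A *v c)) * (c \<bullet> (A *v b)))"
      by (rule C(3)) simp
    also have "\<dots> = (\<Sum>c\<in>C. (b \<bullet> (A *v c))\<^sup>2)"
      unfolding power2_eq_square by (intro sum.cong refl) (metis psd_symmetric[OF A])
    finally show "b \<bullet> (A *v b) = (\<Sum>c\<in>C. (b \<bullet> (A *v c))\<^sup>2)" .
  qed
  also have "\<dots> = (\<Sum>c\<in>C. \<Sum>b\<in>B. (b \<bullet> (A *v c))\<^sup>2)" by (rule sum.swap)
  also have "\<dots> \<le> (\<Sum>c\<in>C. 1)" using le_one by (rule sum_mono)
  finally show ?thesis using \<open>card C \<le> dim U\<close> by simp
qed

text \<open>Take the trace of the eigenvalue equation relative to \<open>Y\<close>, that is, sum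
  over a \<open>Y\<close>-orthonormal \<open>B\<close>. One side becomes \<open>t * card B\<close>;
  on the other, \<open>A i\<close> has range in \<open>V i \<inter> W\<close>, where
  \<open>W\<close> is the range of \<open>Y\<close>, and contributes at most the dimension of that
  space. The dimension condition at \<open>W\<close> finishes. As \<open>Y\<close> may be singular,
  \<open>W\<close> can be a proper subspace.\<close>

lemma psd_eigenvalue_le_one:
  fixes Y :: "real^'n^'n" and A :: "'i \<Rightarrow> real^'n^'n"
  assumes Y: "psd Y" "Y \<noteq> 0"
    and A: "\<And>i. i \<in> I \<Longrightarrow> psd (A i)"
    and AY: "\<And>i x. i \<in> I \<Longrightarrow> x \<bullet> (A i *v x) \<le> x \<bullet> (Y *v x)"
    and range: "\<And>i. i \<in> I \<Longrightarrow> range ((*v) (A i)) \<subseteq> V i"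
    and eigen: "\<And>x. \<tau> * (\<Sum>i\<in>I. x \<bullet> (A i *v x)) = t * (x \<bullet> (Y *v x))"
    and "\<tau> \<ge> 0"
    and dim: "\<And>W. subspace W \<Longrightarrow> \<tau> * (\<Sum>i\<in>I. real (dim (V i \<inter> W))) \<le> real (dim W)"
  shows "t \<le> 1"
proof -
  obtain B where B: "finite B"
    "\<And>b c. b \<in> B \<Longrightarrow> c \<in> B \<Longrightarrow> b \<bullet> (Y *v c) = (if b = c then 1 else 0)"
    "\<And>x y. x \<in> UNIV \<Longrightarrow> x \<bullet> (Y *v y) = (\<Sum>b\<in>B. (x \<bullet> (Y *v b)) * (b \<bullet> (Y *v y)))"
    by (rule psd_orthonormal_basis[OF Y(1) subspace_UNIV]) blast
  define W where "W = span ((*v) Y ` B)"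
  have W: "subspace W" by (simp add: W_def)
  have dimW: "dim W \<le> card B"
    unfolding W_def using B(1)
    by (metis card_image_le dim_le_card' dim_span finite_imageI le_trans)
  have "B \<noteq> {}"
  proof
    assume "B = {}"
    then have "x \<bullet> (Y *v y) = 0" for x y using B(3) by simp
    then have "Y *v y = 0" for y by (metis inner_eq_zero_iff)
    then have "Y = 0" by (simp add: matrix_eq)
    with Y(2) show False by simp
  qed
  have rangeW: "range ((*v) (A i)) \<subseteq> W" if "i \<in> I" for i
  proof (intro image_subsetI)
    fix y
    \<comment> \<open>A vector orthogonal to \<open>W\<close> lies in the kernel of
      \<open>Y\<close>, hence in that of \<open>A i\<close>, which is between 0 and
      \<open>Y\<close>. By symmetry the range of \<open>A i\<close> is orthogonal to it.\<close>
    have "x \<bullet> (A i *v y) = 0" if x: "\<And>w. w \<in> W \<Longrightarrow> x \<bullet> w = 0" for x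
    proof -
      have "x \<bullet> (Y *v b) = 0" if "b \<in> B" for b
        using that by (intro x) (auto simp: W_def intro: span_base)
      then have "x \<bullet> (Y *v x) = 0" using B(3)[of x x] by simp
      then have "x \<bullet> (A i *v x) = 0"
        using AY[OF \<open>i \<in> I\<close>, of x] psd_nonneg[OF A[OF \<open>i \<in> I\<close>], of x] by simp
      then have "A i *v x = 0" by (rule psd_kernel[OF A[OF \<open>i \<in> I\<close>]])
      then show ?thesis using psd_symmetric[OF A[OF \<open>i \<in> I\<close>], of x y] by simp
    qed
    moreover obtain u v where uv: "u \<in> span W" "\<And>w. w \<in> span W \<Longrightarrow> orthogonal v w"
      "A i *v y = u + v"
      using orthogonal_subspace_decomp_exists by metis
    ultimately have "v \<bullet> (A i *v y) = 0"
      by (simp add: orthogonal_def span_base)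
    moreover have "v \<bullet> u = 0" using uv(1,2) by (simp add: orthogonal_def)
    ultimately have "v = 0" by (simp add: uv(3) inner_add_right)
    with uv W show "A i *v y \<in> W" by (metis add.right_neutral span_eq_iff)
  qed
  have "t * real (card B) = (\<Sum>b\<in>B. t * (b \<bullet> (Y *v b)))"
    using B(2) by simp
  also have "\<dots> = \<tau> * (\<Sum>b\<in>B. \<Sum>i\<in>I. b \<bullet> (A i *v b))"
    by (simp add: eigen[symmetric] sum_distrib_left)
  also have "\<dots> = \<tau> * (\<Sum>i\<in>I. \<Sum>b\<in>B. b \<bullet> (A i *v b))"
    by (subst sum.swap) simp
  also have "\<dots> \<le> \<tau> * (\<Sum>i\<in>I. real (dim (V i \<inter> W)))"
    using range rangeW B(1,2) \<open>\<tau> \<ge> 0\<close>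
    by (intro mult_left_mono sum_mono psd_relative_trace_le[OF A AY]) auto
  also have "\<dots> \<le> real (dim W)" by (rule dim[OF W])
  also have "\<dots> \<le> real (card B)" using dimW by simp
  finally have "t * real (card B) \<le> 1 * real (card B)" by simp
  moreover have "real (card B) > 0"
    using B(1) \<open>B \<noteq> {}\<close> by (simp add: card_gt_0_iff)
  ultimately show ?thesis by (metis mult_le_cancel_right_pos)
qed

section \<open>Shorted operators\<close>

definition orth_proj :: "real^'n^'n \<Rightarrow> (real^'n) set \<Rightarrow> bool" where
  "orth_proj P V \<longleftrightarrow> transpose P = P \<and> P ** P = P \<and>
     (\<forall>x. P *v x \<in> V) \<and> (\<forall>x\<in>V. P *v x = x)"

lemma orth_proj_exists:
  fixes V :: "(real^'n) set"
  assumes V: "subspace V"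
  obtains P where "orth_proj P V"
proof -
  \<comment> \<open>With the identity as form, \<open>psd_orthonormal_basis\<close> yields an
    ordinary orthonormal basis of \<open>V\<close>.\<close>
  have "psd (mat 1 :: real^'n^'n)" by (simp add: psd_def)
  note basis = psd_orthonormal_basis[OF this V, unfolded matrix_vector_mul_lid]
  show ?thesis
  proof (rule basis)
    fix B assume B: "finite B" "B \<subseteq> V" "card B \<le> dim V"
      "\<And>b c. b \<in> B \<Longrightarrow> c \<in> B \<Longrightarrow> b \<bullet> c = (if b = c then 1 else 0)"
      "\<And>x y. x \<in> V \<Longrightarrow> x \<bullet> y = (\<Sum>b\<in>B. (x \<bullet> b) * (b \<bullet> y))"
    define P :: "real^'n^'n" where "P = (\<chi> i j. \<Sum>b\<in>B. b $ i * b $ j)"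
    have Px: "P *v x = (\<Sum>b\<in>B. (b \<bullet> x) *\<^sub>R b)" for x
      by (simp add: P_def vec_eq_iff matrix_vector_mult_def inner_vec_def sum_distrib_right
          sum_distrib_left sum.swap[of _ B] mult_ac)
    have PV: "P *v x \<in> V" for x
      unfolding Px using B(2) V by (intro subspace_sum subspace_mul) auto
    have Pid: "P *v x = x" if "x \<in> V" for x
    proof -
      have "(P *v x) \<bullet> y = x \<bullet> y" for y
        unfolding Px using B(5)[OF that, of y] by (simp add: inner_sum_left inner_commute[of x])
      then show ?thesis by (metis vector_eq_rdot)
    qed
    have "transpose P = P"
      by (simp add: P_def transpose_def vec_eq_iff mult.commute)
    moreover have "P ** P = P"
      using Pid PV by (simp add: matrix_eq matrix_vector_mul_assoc[symmetric])
    ultimately have "orth_proj P V"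
      using PV Pid by (simp add: orth_proj_def)
    then show ?thesis by (rule that)
  qed
qed

definition posdef :: "real^'n^'n \<Rightarrow> bool" where
  "posdef A \<longleftrightarrow> transpose A = A \<and> (\<forall>x. x \<noteq> 0 \<longrightarrow> 0 < x \<bullet> (A *v x))"

lemma posdef_imp_psd: "posdef A \<Longrightarrow> psd A"
  unfolding posdef_def psd_def by (metis inner_zero_left less_eq_real_def)

lemma posdef_invertible:
  assumes "posdef A"
  shows "invertible A"
proof -
  have "x = 0" if "A *v x = 0" for x
    using assms that unfolding posdef_def by force
  then show ?thesis
    by (simp add: invertible_left_inverse matrix_left_invertible_ker)
qed

section \<open>Continuity of matrix inversion and matrix algebra\<close>

lemma matrix_inv_inverse:
  assumes "invertible A"
  shows "A ** matrix_inv A = mat 1" "matrix_inv A ** A = mat 1"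
  using someI_ex[of "\<lambda>A'. A ** A' = mat 1 \<and> A' ** A = mat 1"] assms
  by (auto simp: invertible_def matrix_inv_def)

text \<open>Cramer's rule is applied to each column of the inverse. Its entries thus become
  quotients of polynomials in the entries of \<open>A\<close>, from which continuity of inversion
  follows.\<close>

lemma matrix_inv_Cramer:
  fixes A :: "real^'n^'n"
  assumes "invertible A"
  shows "matrix_inv A =
    (\<chi> k l. det (\<chi> i j. if j = k then mat 1 $ i $ l else A $ i $ j) / det A)"
proof -
  have "matrix_inv A $ k $ l = det (\<chi> i j. if j = k then mat 1 $ i $ l else A $ i $ j) / det A"
    for k l
  proof -
    have "A *v column l (matrix_inv A) = (\<chi> i. mat 1 $ i $ l)"
      using matrix_inv_inverse(1)[OF assms]
      by (simp add: vec_eq_iff column_def matrix_vector_mult_def matrix_matrix_mult_def)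
    then have "column l (matrix_inv A) =
        (\<chi> k. det (\<chi> i j. if j = k then (\<chi> i. mat 1 $ i $ l) $ i else A $ i $ j) / det A)"
      using assms by (subst (asm) cramer) (simp_all add: invertible_det_nz)
    then have "column l (matrix_inv A) $ k =
        det (\<chi> i j. if j = k then (\<chi> i. mat 1 $ i $ l) $ i else A $ i $ j) / det A"
      by simp
    then show ?thesis by (simp add: column_def cong: if_cong)
  qed
  then show ?thesis by (simp add: vec_eq_iff)
qed

lemma continuous_on_det [continuous_intros]:
  fixes f :: "'a::topological_space \<Rightarrow> real^'n^'n"
  assumes "continuous_on S f"
  shows "continuous_on S (\<lambda>x. det (f x))"
  unfolding det_def using assms by (intro continuous_intros) auto

lemma continuous_on_matrix_mult [continuous_intros]:
  fixes f :: "'a::topological_space \<Rightarrow> real^'m^'n" and g :: "'a \<Rightarrow> real^'p^'m"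
  assumes "continuous_on S f" "continuous_on S g"
  shows "continuous_on S (\<lambda>x. f x ** g x)"
  unfolding matrix_matrix_mult_def using assms by (intro continuous_intros) auto

lemma continuous_on_matrix_inv:
  fixes f :: "'a::topological_space \<Rightarrow> real^'n^'n"
  assumes "continuous_on S f" "\<And>x. x \<in> S \<Longrightarrow> invertible (f x)"
  shows "continuous_on S (\<lambda>x. matrix_inv (f x))"
proof -
  have "continuous_on S (\<lambda>x. if j = k then mat 1 $ i $ l else f x $ i $ j)" for i j k l :: 'n
    using assms(1) by (cases "j = k") (auto intro!: continuous_intros)
  then have "continuous_on S (\<lambda>x. \<chi> k l.
      det (\<chi> i j. if j = k then mat 1 $ i $ l else f x $ i $ j) / det (f x))"
    using assms by (intro continuous_intros) (auto simp: invertible_det_nz)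
  then show ?thesis
    using assms(2) matrix_inv_Cramer by (subst continuous_on_cong[OF refl]) auto
qed

lemma matrix_diff_ldistrib: "A ** (B - C) = A ** B - A ** C" for A :: "real^'m^'n"
  by (vector matrix_matrix_mult_def sum_subtractf right_diff_distrib)

lemma matrix_diff_rdistrib: "(A - B) ** C = A ** C - B ** C" for A :: "real^'m^'n"
  by (vector matrix_matrix_mult_def sum_subtractf left_diff_distrib)

lemma matrix_add_rdistrib: "(A + B) ** C = A ** C + B ** C" for A :: "real^'m^'n"
  by (vector matrix_matrix_mult_def sum.distrib distrib_right)

lemma transpose_add: "transpose (A + B) = transpose A + transpose B"
  by (simp add: transpose_def vec_eq_iff)

lemma transpose_diff: "transpose (A - B) = transpose A - transpose B"
  by (simp add: transpose_def vec_eq_iff)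

text \<open>
  If \<open>P\<close> is the orthogonal projection onto \<open>V\<close>, this is the shorted operator of \<open>Z\<close> to \<open>V\<close>, the Schur
  complement of the block of \<open>Z\<close> on the orthogonal complement of \<open>V\<close>. Adding \<open>P\<close> to that block
  makes it invertible on the whole space.
\<close>

definition shorted :: "real^'n^'n \<Rightarrow> real^'n^'n \<Rightarrow> real^'n^'n" where
  "shorted P Z = Z - Z ** (matrix_inv (P + (mat 1 - P) ** Z ** (mat 1 - P)) ** (mat 1 - P)) ** Z"

lemma inner_matrix_congruence:
  fixes E Z :: "real^'n^'n"
  shows "x \<bullet> ((transpose E ** Z ** E) *v x) = (E *v x) \<bullet> (Z *v (E *v x))"
  using inner_matrix_vector_transpose[of x "transpose E" "Z *v (E *v x)"]
  by (simp only: matrix_vector_mul_assoc matrix_mul_assoc transpose_transpose)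

text \<open>The form splits into the squared length of \<open>P *v x\<close> plus the
  \<open>Z\<close>-form of the complementary component, and the two components of a nonzero vector
  cannot both vanish.\<close>

lemma posdef_compression:
  assumes P: "orth_proj P V" and Z: "posdef Z"
  shows "posdef (P + (mat 1 - P) ** Z ** (mat 1 - P))"
proof -
  define N where "N = mat 1 - P"
  have tP: "transpose P = P" and PP: "P ** P = P" using P by (auto simp: orth_proj_def)
  have tZ: "transpose Z = Z" using Z by (simp add: posdef_def)
  have tN: "transpose N = N" by (simp add: N_def transpose_diff tP)
  have form: "x \<bullet> ((P + N ** Z ** N) *v x) = (P *v x) \<bullet> (P *v x) + (N *v x) \<bullet> (Z *v (N *v x))" for x
  proof -
    have "x \<bullet> (P *v x) = x \<bullet> (P *v (P *v x))"
      by (simp add: matrix_vector_mul_assoc PP)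
    also have "\<dots> = (P *v x) \<bullet> (P *v x)"
      by (subst inner_matrix_vector_transpose) (simp only: tP)
    finally have "x \<bullet> (P *v x) = (P *v x) \<bullet> (P *v x)" .
    moreover have "x \<bullet> ((N ** Z ** N) *v x) = (N *v x) \<bullet> (Z *v (N *v x))"
      using inner_matrix_congruence[of x N Z] by (simp only: tN)
    ultimately show ?thesis by (simp add: matrix_vector_mult_add_rdistrib inner_add_right)
  qed
  have "0 < x \<bullet> ((P + N ** Z ** N) *v x)" if "x \<noteq> 0" for x
  proof (cases "N *v x = 0")
    case True
    then have "P *v x = x" by (simp add: N_def matrix_vector_mult_diff_rdistrib)
    with True that show ?thesis by (simp add: form)
  next
    case False
    then have "0 < (N *v x) \<bullet> (Z *v (N *v x))" using Z by (simp add: posdef_def)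
    then show ?thesis unfolding form by (simp add: add_nonneg_pos)
  qed
  moreover have "transpose (P + N ** Z ** N) = P + N ** Z ** N"
    by (simp add: transpose_add matrix_transpose_mul tP tN tZ matrix_mul_assoc)
  ultimately show ?thesis by (simp add: posdef_def N_def)
qed

text \<open>\<open>R\<close> inverts the block of \<open>Z\<close> on the complement of
  \<open>V\<close> and vanishes on \<open>V\<close>, so \<open>N ** Z ** R = N\<close> and
  \<open>R ** Z ** R = R\<close>. The second identity makes both the shorted operator and its
  difference from \<open>Z\<close> congruence transforms of \<open>Z\<close>, hence positive
  semidefinite; the first makes \<open>N\<close> annihilate the shorted operator. In the last claim
  \<open>X\<close> is the inverse of \<open>Z\<close>, and the correction term drops out because
  \<open>R\<close> vanishes on \<open>V\<close>.\<close>

lemma shorted_properties: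
  assumes P: "orth_proj P V" and Z: "posdef Z"
  shows "psd (shorted P Z)"
    and "x \<bullet> (shorted P Z *v x) \<le> x \<bullet> (Z *v x)"
    and "range ((*v) (shorted P Z)) \<subseteq> V"
    and "v \<in> V \<Longrightarrow> Z ** X = mat 1 \<Longrightarrow> shorted P Z *v (X *v v) = v"
proof -
  define N where "N = mat 1 - P"
  define T where "T = P + N ** Z ** N"
  define J where "J = matrix_inv T"
  define R where "R = J ** N"
  have S: "shorted P Z = Z - Z ** R ** Z"
    by (simp add: shorted_def R_def J_def T_def N_def)
  have tP: "transpose P = P" and PP: "P ** P = P" using P by (auto simp: orth_proj_def)
  have tZ: "transpose Z = Z" using Z by (simp add: posdef_def)
  have tN: "transpose N = N" by (simp add: N_def transpose_diff tP)
  have NN: "N ** N = N" and PN: "P ** N = 0" and NP: "N ** P = 0"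
    by (simp_all add: N_def matrix_diff_ldistrib matrix_diff_rdistrib PP)
  have T: "posdef T" unfolding T_def N_def by (rule posdef_compression[OF P Z])
  have TJ: "T ** J = mat 1" and JT: "J ** T = mat 1"
    unfolding J_def using matrix_inv_inverse posdef_invertible[OF T] by auto
  have tT: "transpose T = T" using T by (simp add: posdef_def)
  have tJ: "transpose J = J"
  proof -
    have "transpose J ** T = mat 1"
      using TJ by (metis matrix_transpose_mul tT transpose_mat)
    then show ?thesis by (metis TJ matrix_mul_assoc matrix_mul_lid matrix_mul_rid)
  qed
  have PT: "P ** T = P"
    by (simp add: T_def matrix_add_ldistrib matrix_mul_assoc PP PN)
  have PJ: "P ** J = P" by (metis PT TJ matrix_mul_assoc matrix_mul_rid)
  \<comment> \<open>\<open>T\<close> is block diagonal for the splitting by \<open>P\<close> and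
    \<open>N\<close>, so its inverse also commutes with \<open>N\<close>; this makes
    \<open>R\<close> symmetric.\<close>
  have "T ** N = N ** T"
    by (simp add: T_def matrix_add_ldistrib matrix_add_rdistrib PN NP matrix_mul_assoc NN)
       (simp add: matrix_mul_assoc[symmetric] NN)
  then have R': "R = N ** J"
    unfolding R_def by (metis JT TJ matrix_mul_assoc matrix_mul_lid matrix_mul_rid)
  have tR: "transpose R = R"
    by (metis R_def R' matrix_transpose_mul tJ tN)
  have RN: "R ** N = R" by (simp add: R_def matrix_mul_assoc[symmetric] NN)
  have NZR: "N ** Z ** R = N"
  proof -
    have "N ** Z ** R = (T - P) ** J" by (simp add: R' T_def matrix_mul_assoc)
    also have "\<dots> = N" by (simp add: matrix_diff_rdistrib TJ PJ N_def)
    finally show ?thesis .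
  qed
  have RZR: "R ** Z ** R = R"
    by (metis NZR RN matrix_mul_assoc)
  have tS: "transpose (shorted P Z) = shorted P Z"
    by (simp add: S transpose_diff matrix_transpose_mul tR tZ matrix_mul_assoc)
  define E where "E = mat 1 - R ** Z"
  have "transpose E ** Z ** E = Z - Z ** R ** Z - Z ** R ** Z + Z ** (R ** Z ** R) ** Z"
    by (simp add: E_def transpose_diff matrix_transpose_mul tR tZ matrix_diff_ldistrib
        matrix_diff_rdistrib matrix_mul_assoc)
  then have EZE: "shorted P Z = transpose E ** Z ** E" by (simp add: S RZR)
  have "x \<bullet> (shorted P Z *v x) = (E *v x) \<bullet> (Z *v (E *v x))" for x
    by (simp only: EZE inner_matrix_congruence)
  then show "psd (shorted P Z)"
    using tS psd_nonneg[OF posdef_imp_psd[OF Z]] by (simp add: psd_def)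
  have "Z ** R ** Z = transpose (R ** Z) ** Z ** (R ** Z)"
    by (simp add: matrix_transpose_mul tR tZ matrix_mul_assoc)
       (simp add: matrix_mul_assoc[symmetric] RZR[unfolded matrix_mul_assoc[symmetric]])
  then have "x \<bullet> ((Z ** R ** Z) *v x) = ((R ** Z) *v x) \<bullet> (Z *v ((R ** Z) *v x))"
    by (simp only: inner_matrix_congruence)
  then have "0 \<le> x \<bullet> ((Z ** R ** Z) *v x)"
    using psd_nonneg[OF posdef_imp_psd[OF Z]] by simp
  then show "x \<bullet> (shorted P Z *v x) \<le> x \<bullet> (Z *v x)"
    by (simp add: S matrix_vector_mult_diff_rdistrib inner_diff_right)
  have NS: "N ** shorted P Z = 0"
    by (simp add: S matrix_diff_ldistrib matrix_mul_assoc NZR)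
  show "range ((*v) (shorted P Z)) \<subseteq> V"
  proof (intro image_subsetI)
    fix y
    have "N *v (shorted P Z *v y) = 0" by (simp add: matrix_vector_mul_assoc NS)
    then have "P *v (shorted P Z *v y) = shorted P Z *v y"
      by (simp add: N_def matrix_vector_mult_diff_rdistrib)
    then show "shorted P Z *v y \<in> V" using P by (metis orth_proj_def)
  qed
  show "shorted P Z *v (X *v v) = v" if "v \<in> V" "Z ** X = mat 1"
  proof -
    have "N *v v = 0" using P that(1)
      by (simp add: N_def matrix_vector_mult_diff_rdistrib orth_proj_def)
    then have "R *v v = 0" by (simp add: R_def matrix_vector_mul_assoc[symmetric])
    moreover have "shorted P Z *v (X *v v) = (Z ** X) *v v - Z *v (R *v ((Z ** X) *v v))"
      by (simp add: S matrix_vector_mult_diff_rdistrib matrix_diff_rdistrib matrix_vector_mul_assoc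
          matrix_mul_assoc)
    ultimately show ?thesis by (simp add: that(2))
  qed
qed

lemma continuous_on_shorted:
  assumes P: "orth_proj P V" and f: "continuous_on S f" and pd: "\<And>x. x \<in> S \<Longrightarrow> posdef (f x)"
  shows "continuous_on S (\<lambda>x. shorted P (f x))"
  unfolding shorted_def
  by (intro continuous_intros continuous_on_matrix_inv f posdef_invertible posdef_compression[OF P] pd)

section \<open>A balanced inner product\<close>

lemma matrix_entry_eq_form: "A $ i $ j = axis i 1 \<bullet> (A *v axis j 1)" for A :: "real^'n^'m"
  by (simp add: inner_axis' matrix_vector_mult_basis column_def)

lemma trace_mono_form:
  fixes A B :: "real^'n^'n"
  assumes "\<And>x. x \<bullet> (A *v x) \<le> x \<bullet> (B *v x)"
  shows "trace A \<le> trace B"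
  unfolding trace_def by (intro sum_mono) (simp add: matrix_entry_eq_form assms)

lemma psd_trace_nonneg: "psd A \<Longrightarrow> 0 \<le> trace A"
  using trace_mono_form[of 0 A] by (simp add: psd_nonneg trace_def)

text \<open>Cauchy-Schwarz at coordinate vectors bounds every entry by diagonal entries, hence by
  the trace. The constant is crude; it serves only to show boundedness.\<close>

lemma psd_norm_le_trace:
  fixes A :: "real^'n^'n"
  assumes "psd A"
  shows "norm A \<le> (real CARD('n))\<^sup>2 * trace A"
proof -
  have diag: "0 \<le> A $ i $ i" "A $ i $ i \<le> trace A" for i
  proof -
    show nonneg: "0 \<le> A $ i $ i" for i
      using psd_nonneg[OF assms] by (simp add: matrix_entry_eq_form)
    show "A $ i $ i \<le> trace A"
      unfolding trace_def using nonneg by (intro member_le_sum) auto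
  qed
  have entry: "\<bar>A $ i $ j\<bar> \<le> trace A" for i j
  proof -
    have "(A $ i $ j)\<^sup>2 \<le> A $ i $ i * A $ j $ j"
      using psd_Cauchy_Schwarz[OF assms, of "axis i 1" "axis j 1"]
      by (simp only: matrix_entry_eq_form)
    also have "\<dots> \<le> (trace A)\<^sup>2"
      using diag psd_trace_nonneg[OF assms] unfolding power2_eq_square
      by (intro mult_mono) auto
    finally show ?thesis
      using psd_trace_nonneg[OF assms] by (metis abs_le_square_iff abs_of_nonneg)
  qed
  have "norm A \<le> (\<Sum>i\<in>UNIV. norm (A $ i))"
    by (simp add: norm_vec_def L2_set_le_sum)
  also have "\<dots> \<le> (\<Sum>i\<in>UNIV. \<Sum>j\<in>UNIV. \<bar>A $ i $ j\<bar>)"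
    by (intro sum_mono norm_le_l1_cart)
  also have "\<dots> \<le> (\<Sum>i\<in>(UNIV::'n set). \<Sum>j\<in>(UNIV::'n set). trace A)"
    by (intro sum_mono entry)
  also have "\<dots> = (real CARD('n))\<^sup>2 * trace A" by (simp add: power2_eq_square)
  finally show ?thesis .
qed

lemma tendsto_matrix_vector_mult [tendsto_intros]:
  fixes f :: "'a \<Rightarrow> real^'n^'m"
  assumes "(f \<longlongrightarrow> A) F"
  shows "((\<lambda>k. f k *v x) \<longlongrightarrow> A *v x) F"
  unfolding matrix_vector_mult_def using assms by (intro tendsto_intros) auto

lemma tendsto_trace [tendsto_intros]:
  fixes f :: "'a \<Rightarrow> real^'n^'n"
  assumes "(f \<longlongrightarrow> A) F"
  shows "((\<lambda>k. trace (f k)) \<longlongrightarrow> trace A) F"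
  unfolding trace_def using assms by (intro tendsto_intros) auto

lemma psd_limit:
  fixes f :: "nat \<Rightarrow> real^'n^'n"
  assumes lim: "f \<longlonglongrightarrow> A" and psd: "\<And>k. psd (f k)"
  shows "psd A"
proof -
  have "A $ j $ i = A $ i $ j" for i j
  proof -
    have "f k $ j $ i = f k $ i $ j" for k
      using psd_symmetric[OF psd] by (simp add: matrix_entry_eq_form)
    then have "(\<lambda>k. f k $ i $ j) \<longlonglongrightarrow> A $ j $ i"
      using tendsto_vec_nth[OF tendsto_vec_nth[OF lim, of j], of i] by simp
    moreover have "(\<lambda>k. f k $ i $ j) \<longlonglongrightarrow> A $ i $ j"
      using lim by (intro tendsto_intros)
    ultimately show ?thesis by (rule LIMSEQ_unique)
  qed
  moreover have "0 \<le> x \<bullet> (A *v x)" for x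
  proof (rule LIMSEQ_le_const)
    show "(\<lambda>k. x \<bullet> (f k *v x)) \<longlonglongrightarrow> x \<bullet> (A *v x)"
      using lim by (intro tendsto_intros)
  qed (use psd psd_nonneg in auto)
  ultimately show ?thesis by (simp add: psd_def transpose_def vec_eq_iff)
qed

lemma compact_density_matrices: "compact {Y :: real^'n^'n. psd Y \<and> trace Y = 1}"
proof -
  have "bounded {Y :: real^'n^'n. psd Y \<and> trace Y = 1}"
    unfolding bounded_iff using psd_norm_le_trace by fastforce
  moreover have "closed {Y :: real^'n^'n. psd Y \<and> trace Y = 1}"
    unfolding closed_sequential_limits
  proof (intro allI impI, elim conjE)
    fix f :: "nat \<Rightarrow> real^'n^'n" and A
    assume f: "\<forall>k. f k \<in> {Y. psd Y \<and> trace Y = 1}" and lim: "f \<longlonglongrightarrow> A"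
    then have "psd A" using psd_limit[OF lim] by simp
    moreover have "trace A = 1"
      using tendsto_trace[OF lim] f by (simp add: LIMSEQ_const_iff)
    ultimately show "A \<in> {Y. psd Y \<and> trace Y = 1}" by simp
  qed
  ultimately show ?thesis by (simp add: compact_eq_bounded_closed)
qed

lemma trace_scaleR: "trace (c *\<^sub>R A) = c * trace A" for A :: "real^'n^'n"
  by (simp add: trace_def sum_distrib_left)

lemma trace_sum: "trace (\<Sum>i\<in>I. A i) = (\<Sum>i\<in>I. trace (A i))" for A :: "'i \<Rightarrow> real^'n^'n"
  unfolding trace_def by (simp add: sum.swap[of _ I])

lemma psd_add: "psd A \<Longrightarrow> psd B \<Longrightarrow> psd (A + B)"
  by (simp add: psd_def transpose_add matrix_vector_mult_add_rdistrib inner_add_right)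

lemma psd_scaleR: "psd A \<Longrightarrow> 0 \<le> c \<Longrightarrow> psd (c *\<^sub>R A)"
  by (simp add: psd_def transpose_scalar scaleR_matrix_vector_assoc[symmetric])

lemma psd_sum: "(\<And>i. i \<in> I \<Longrightarrow> psd (A i)) \<Longrightarrow> psd (\<Sum>i\<in>I. A i)"
proof (induction I rule: infinite_finite_induct)
  case (insert i I)
  then show ?case by (simp add: psd_add)
qed (simp_all add: psd_def transpose_def vec_eq_iff)

lemma psd_mat_1: "psd (mat 1)"
  by (simp add: psd_def)

lemma convex_density_matrices: "convex {Y :: real^'n^'n. psd Y \<and> trace Y = 1}"
  by (auto simp: convex_def psd_add psd_scaleR trace_add trace_scaleR)

lemma posdef_add_mat:
  assumes "psd Y" "\<epsilon> > 0"
  shows "posdef (Y + \<epsilon> *\<^sub>R mat 1)"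
  using assms psd_nonneg[OF assms(1)]
  by (auto simp: posdef_def psd_def transpose_add transpose_scalar matrix_vector_mult_add_rdistrib
      scaleR_matrix_vector_assoc[symmetric] inner_add_right intro!: add_nonneg_pos)

lemma sum_matrix_vector_mult: "(\<Sum>i\<in>I. A i) *v x = (\<Sum>i\<in>I. A i *v x)" for A :: "'i \<Rightarrow> real^'n^'m"
  by (induction I rule: infinite_finite_induct) (simp_all add: matrix_vector_mult_add_rdistrib)

text \<open>Brouwer's theorem for the trace-normalised map on density matrices; \<open>t\<close> is
  the normalising trace. The regularisation acts twice: the shift inside keeps the argument of
  \<open>shorted\<close> positive definite, so that the map is continuous even at singular
  \<open>Y\<close>, and the multiple of the identity outside keeps the trace positive, so that
  normalising is possible.\<close>

lemma shorted_fixed_point: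
  fixes P :: "'i \<Rightarrow> real^'n^'n"
  assumes P: "\<And>i. i \<in> I \<Longrightarrow> orth_proj (P i) (V i)" and "\<tau> \<ge> 0" "\<epsilon> > 0"
  obtains Y t where "psd Y" "trace Y = 1"
    "t *\<^sub>R Y = \<tau> *\<^sub>R (\<Sum>i\<in>I. shorted (P i) (Y + \<epsilon> *\<^sub>R mat 1)) + \<epsilon> *\<^sub>R mat 1"
proof -
  define K where "K = {Y :: real^'n^'n. psd Y \<and> trace Y = 1}"
  define g where "g Y = \<tau> *\<^sub>R (\<Sum>i\<in>I. shorted (P i) (Y + \<epsilon> *\<^sub>R mat 1)) + \<epsilon> *\<^sub>R mat 1" for Y
  define f where "f Y = (1 / trace (g Y)) *\<^sub>R g Y" for Y
  have pd: "posdef (Y + \<epsilon> *\<^sub>R mat 1)" if "Y \<in> K" for Y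
    using that \<open>\<epsilon> > 0\<close> by (simp add: K_def posdef_add_mat)
  have short_psd: "psd (\<Sum>i\<in>I. shorted (P i) (Y + \<epsilon> *\<^sub>R mat 1))" if "Y \<in> K" for Y
    using P pd[OF that] by (intro psd_sum shorted_properties(1))
  have g_psd: "psd (g Y)" if "Y \<in> K" for Y
    unfolding g_def using short_psd[OF that] \<open>\<tau> \<ge> 0\<close> \<open>\<epsilon> > 0\<close>
    by (intro psd_add psd_scaleR psd_mat_1) auto
  have g_trace: "trace (g Y) > 0" if "Y \<in> K" for Y
    unfolding g_def trace_add trace_scaleR trace_I
    using psd_trace_nonneg[OF short_psd[OF that]] \<open>\<tau> \<ge> 0\<close> \<open>\<epsilon> > 0\<close>
    by (intro add_nonneg_pos) auto
  have "continuous_on K g"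
    unfolding g_def using pd P
    by (intro continuous_intros continuous_on_shorted) auto
  moreover have "continuous_on K (\<lambda>Y. trace (g Y))"
    unfolding trace_def using \<open>continuous_on K g\<close> by (intro continuous_intros)
  ultimately have cont: "continuous_on K f"
    unfolding f_def by (intro continuous_intros) (auto dest!: g_trace)
  have "f Y \<in> K" if "Y \<in> K" for Y
    using g_psd[OF that] g_trace[OF that]
    by (simp add: K_def f_def psd_scaleR trace_scaleR)
  then have maps: "f \<in> K \<rightarrow> K" by blast
  have "(1 / real (CARD('n))) *\<^sub>R mat 1 \<in> K"
    by (simp add: K_def psd_scaleR psd_mat_1 trace_scaleR trace_I)
  then have nonempty: "K \<noteq> {}" by blast
  have K: "compact K" "convex K"
    unfolding K_def by (rule compact_density_matrices convex_density_matrices)+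
  obtain Y where Y: "Y \<in> K" "f Y = Y"
    by (rule brouwer[OF K nonempty cont maps])
  then have "trace (g Y) *\<^sub>R Y = trace (g Y) *\<^sub>R f Y" by simp
  also have "\<dots> = g Y" using g_trace[OF Y(1)] by (simp add: f_def)
  finally show ?thesis using that Y(1) by (auto simp: K_def g_def)
qed

text \<open>The subsequence is refined once for each index; convergence already achieved survives
  refinement.\<close>

lemma common_convergent_subsequence:
  fixes f :: "'i \<Rightarrow> nat \<Rightarrow> 'a::heine_borel"
  assumes "finite I" "\<And>i. i \<in> I \<Longrightarrow> bounded (range (f i))"
  obtains r where "strict_mono (r :: nat \<Rightarrow> nat)" "\<And>i. i \<in> I \<Longrightarrow> convergent (f i \<circ> r)"
proof -
  from assms have "\<exists>r :: nat \<Rightarrow> nat. strict_mono r \<and> (\<forall>i\<in>I. convergent (f i \<circ> r))"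
  proof (induction I rule: finite_induct)
    case empty
    show ?case using strict_mono_id by auto
  next
    case (insert i I)
    then obtain r :: "nat \<Rightarrow> nat" where r: "strict_mono r" "\<And>j. j \<in> I \<Longrightarrow> convergent (f j \<circ> r)"
      using insert.IH insert.prems by blast
    have "bounded (range (f i \<circ> r))"
      using insert.prems[of i] by (rule bounded_subset) auto
    then obtain l s where s: "strict_mono s" "((f i \<circ> r) \<circ> s) \<longlonglongrightarrow> l"
      using bounded_imp_convergent_subsequence by blast
    have "convergent (f j \<circ> (r \<circ> s))" if "j \<in> insert i I" for j
    proof (cases "j = i")
      case True
      with s(2) show ?thesis by (auto simp: convergent_def comp_assoc)
    next
      case False
      with that have "convergent ((f j \<circ> r) \<circ> s)"
        using convergent_subseq_convergent[OF r(2) s(1)] by auto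
      then show ?thesis by (simp add: comp_assoc)
    qed
    moreover have "strict_mono (r \<circ> s)" using r(1) s(1) by (rule strict_mono_o)
    ultimately show ?case by blast
  qed
  with that show ?thesis by blast
qed

text \<open>If some regularised fixed point has eigenvalue at most 2, its shifted matrix is the
  desired \<open>Z\<close>. Otherwise a limit of fixed points satisfies the unregularised equation
  with eigenvalue at least 2, against \<open>psd_eigenvalue_le_one\<close>. The limit could be
  singular, so it serves only for the contradiction and not as \<open>Z\<close>.\<close>

lemma shorted_balanced:
  fixes V :: "'i \<Rightarrow> (real^'n) set" and P :: "'i \<Rightarrow> real^'n^'n"
  assumes "finite I" and P: "\<And>i. i \<in> I \<Longrightarrow> orth_proj (P i) (V i)"
    and V: "\<And>i. i \<in> I \<Longrightarrow> subspace (V i)" and "\<tau> \<ge> 0"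
    and dim: "\<And>W. subspace W \<Longrightarrow> \<tau> * (\<Sum>i\<in>I. real (dim (V i \<inter> W))) \<le> real (dim W)"
  obtains Z where "posdef Z" "\<And>x. \<tau> * (\<Sum>i\<in>I. x \<bullet> (shorted (P i) Z *v x)) \<le> 2 * (x \<bullet> (Z *v x))"
proof -
  define \<epsilon> :: "nat \<Rightarrow> real" where "\<epsilon> m = 1 / real (Suc m)" for m
  have \<epsilon>: "\<epsilon> m > 0" "\<epsilon> m \<le> 1" for m by (simp_all add: \<epsilon>_def)
  have "\<exists>Y t. psd Y \<and> trace Y = 1 \<and>
      t *\<^sub>R Y = \<tau> *\<^sub>R (\<Sum>i\<in>I. shorted (P i) (Y + \<epsilon> m *\<^sub>R mat 1)) + \<epsilon> m *\<^sub>R mat 1" for m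
    using shorted_fixed_point[of I P V \<tau> "\<epsilon> m"] P \<open>\<tau> \<ge> 0\<close> \<epsilon>(1)[of m] by metis
  then obtain Y t where Y: "\<And>m. psd (Y m)" "\<And>m. trace (Y m) = 1" and
    fp: "\<And>m. t m *\<^sub>R Y m = \<tau> *\<^sub>R (\<Sum>i\<in>I. shorted (P i) (Y m + \<epsilon> m *\<^sub>R mat 1)) + \<epsilon> m *\<^sub>R mat 1"
    by metis
  define Z where "Z m = Y m + \<epsilon> m *\<^sub>R mat 1" for m
  have Z: "posdef (Z m)" for m
    unfolding Z_def using Y(1) \<epsilon>(1) by (rule posdef_add_mat)
  define S where "S i m = shorted (P i) (Z m)" for i m
  have fpS: "t m *\<^sub>R Y m = \<tau> *\<^sub>R (\<Sum>i\<in>I. S i m) + \<epsilon> m *\<^sub>R mat 1" for m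
    using fp[of m] by (simp add: S_def Z_def)
  have S: "psd (S i m)" "x \<bullet> (S i m *v x) \<le> x \<bullet> (Z m *v x)" "range ((*v) (S i m)) \<subseteq> V i"
    if "i \<in> I" for i m x
    unfolding S_def using shorted_properties[OF P[OF that] Z] by blast+
  have form: "t m * (x \<bullet> (Y m *v x)) = \<tau> * (\<Sum>i\<in>I. x \<bullet> (S i m *v x)) + \<epsilon> m * (x \<bullet> x)" for m x
  proof -
    have "t m * (x \<bullet> (Y m *v x)) = x \<bullet> ((t m *\<^sub>R Y m) *v x)"
      by (simp add: scaleR_matrix_vector_assoc[symmetric])
    also have "\<dots> = \<tau> * (\<Sum>i\<in>I. x \<bullet> (S i m *v x)) + \<epsilon> m * (x \<bullet> x)"
      unfolding fpS by (simp add: scaleR_matrix_vector_assoc[symmetric] matrix_vector_mult_add_rdistrib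
          inner_add_right sum_matrix_vector_mult inner_sum_right)
    finally show ?thesis .
  qed
  show ?thesis
  proof (cases "\<exists>m. t m \<le> 2")
    case True
    then obtain m where m: "t m \<le> 2" by blast
    have "\<tau> * (\<Sum>i\<in>I. x \<bullet> (S i m *v x)) \<le> 2 * (x \<bullet> (Z m *v x))" for x
    proof -
      have "\<tau> * (\<Sum>i\<in>I. x \<bullet> (S i m *v x)) \<le> t m * (x \<bullet> (Y m *v x))"
        using form[of m x] \<epsilon>(1)[of m] by simp
      also have "\<dots> \<le> 2 * (x \<bullet> (Y m *v x))"
        using m psd_nonneg[OF Y(1)] by (rule mult_right_mono)
      also have "x \<bullet> (Y m *v x) \<le> x \<bullet> (Z m *v x)"
        using \<epsilon>(1)[of m] by (simp add: Z_def matrix_vector_mult_add_rdistrib inner_add_right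
            scaleR_matrix_vector_assoc[symmetric])
      finally show ?thesis by simp
    qed
    then show ?thesis unfolding S_def by (rule that[OF Z])
  next
    case False
    then have t: "t m \<ge> 2" for m by (meson less_imp_le not_le)
    \<comment> \<open>\<open>None\<close> stands for \<open>Y\<close> and \<open>Some i\<close> for
      \<open>S i\<close>, so that a single subsequence makes all of them converge.\<close>
    define f where "f = case_option Y S"
    have bounded_f: "bounded (range (f j))" if "j \<in> insert None (Some ` I)" for j
    proof -
      have "norm (f j m) \<le> (real CARD('n))\<^sup>2 * (1 + real CARD('n))" for m
      proof (cases j)
        case None
        then have "norm (f j m) \<le> (real CARD('n))\<^sup>2 * 1"
          using psd_norm_le_trace[OF Y(1), of m] Y(2) by (simp add: f_def)
        also have "\<dots> \<le> (real CARD('n))\<^sup>2 * (1 + real CARD('n))"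
          by (intro mult_left_mono) auto
        finally show ?thesis .
      next
        case (Some i)
        with that have i: "i \<in> I" by auto
        have "trace (S i m) \<le> trace (Z m)" using S(2)[OF i] by (rule trace_mono_form)
        also have "\<dots> \<le> 1 + real CARD('n)"
          using \<epsilon>(2)[of m] by (simp add: Z_def trace_add trace_scaleR trace_I Y(2) mult_left_le_one_le)
        finally have "(real CARD('n))\<^sup>2 * trace (S i m) \<le> (real CARD('n))\<^sup>2 * (1 + real CARD('n))"
          by (intro mult_left_mono) auto
        with psd_norm_le_trace[OF S(1)[OF i], of m]
        have "norm (S i m) \<le> (real CARD('n))\<^sup>2 * (1 + real CARD('n))" by (rule order_trans)
        with Some show ?thesis by (simp add: f_def)
      qed
      then show ?thesis unfolding bounded_iff by blast
    qed
    obtain r where r: "strict_mono (r :: nat \<Rightarrow> nat)"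
      "\<And>j. j \<in> insert None (Some ` I) \<Longrightarrow> convergent (f j \<circ> r)"
      using common_convergent_subsequence[of "insert None (Some ` I)" f] bounded_f \<open>finite I\<close>
      by (metis finite.insertI finite_imageI)
    have "convergent (Y \<circ> r)" using r(2)[of None] by (simp add: f_def)
    then obtain Y' where Y': "(Y \<circ> r) \<longlonglongrightarrow> Y'" by (auto simp: convergent_def)
    have "convergent (S i \<circ> r)" if "i \<in> I" for i using r(2)[of "Some i"] that by (simp add: f_def)
    then have "\<forall>i\<in>I. \<exists>A. (S i \<circ> r) \<longlonglongrightarrow> A" by (simp add: convergent_def)
    then obtain A where A: "\<And>i. i \<in> I \<Longrightarrow> (S i \<circ> r) \<longlonglongrightarrow> A i" by metis
    have "\<epsilon> \<longlonglongrightarrow> 0" unfolding \<epsilon>_def using LIMSEQ_inverse_real_of_nat by (simp add: inverse_eq_divide)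
    then have \<epsilon>r: "(\<epsilon> \<circ> r) \<longlonglongrightarrow> 0" using r(1) by (rule LIMSEQ_subseq_LIMSEQ)
    have Yx: "(\<lambda>m. x \<bullet> (Y (r m) *v x)) \<longlonglongrightarrow> x \<bullet> (Y' *v x)" for x
      using Y' unfolding comp_def by (intro tendsto_intros)
    have Sx: "(\<lambda>m. x \<bullet> (S i (r m) *v y)) \<longlonglongrightarrow> x \<bullet> (A i *v y)" if "i \<in> I" for i x y
      using A[OF that] unfolding comp_def by (intro tendsto_intros)
    have trY': "trace Y' = 1"
      using tendsto_trace[OF Y'] by (simp add: Y(2) LIMSEQ_const_iff)
    have psdY': "psd Y'" using psd_limit[OF Y'] Y(1) by simp
    \<comment> \<open>Each \<open>Y m\<close> has trace 1, so the trace of the fixed point equation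
      expresses \<open>t m\<close> through the traces of the \<open>S i m\<close>; hence the
      eigenvalues converge too.\<close>
    define t' where "t' = \<tau> * (\<Sum>i\<in>I. trace (A i))"
    have t'_lim: "(\<lambda>m. t (r m)) \<longlonglongrightarrow> t'"
    proof -
      have "t m = \<tau> * (\<Sum>i\<in>I. trace (S i m)) + \<epsilon> m * real CARD('n)" for m
        using arg_cong[OF fpS[of m], of trace]
        by (simp add: trace_add trace_scaleR trace_sum trace_I Y(2))
      moreover have "(\<lambda>m. \<tau> * (\<Sum>i\<in>I. trace (S i (r m))) + \<epsilon> (r m) * real CARD('n)) \<longlonglongrightarrow>
          t' + 0 * real CARD('n)"
        unfolding t'_def using A \<epsilon>r unfolding comp_def by (intro tendsto_intros) auto
      ultimately show ?thesis by simp
    qed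
    have "t' \<le> 1"
    proof (rule psd_eigenvalue_le_one[of Y' I A V \<tau> t'])
      show "psd Y'" by (rule psdY')
      show "Y' \<noteq> 0" using trY' by (auto simp: trace_def)
      show "psd (A i)" if "i \<in> I" for i using psd_limit[OF A[OF that]] S(1)[OF that] by simp
      show "x \<bullet> (A i *v x) \<le> x \<bullet> (Y' *v x)" if "i \<in> I" for i x
      proof (rule LIMSEQ_le[OF Sx[OF that]])
        \<comment> \<open>\<open>S i m\<close> lies below the shifted matrix \<open>Z m\<close>, not
          below \<open>Y m\<close>; the shift disappears in the limit.\<close>
        have "(\<lambda>m. x \<bullet> (Y (r m) *v x) + \<epsilon> (r m) * (x \<bullet> x)) \<longlonglongrightarrow> x \<bullet> (Y' *v x) + 0 * (x \<bullet> x)"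
          using \<epsilon>r unfolding comp_def by (intro tendsto_add tendsto_mult tendsto_const Yx)
        then show "(\<lambda>m. x \<bullet> (Y (r m) *v x) + \<epsilon> (r m) * (x \<bullet> x)) \<longlonglongrightarrow> x \<bullet> (Y' *v x)"
          by simp
        show "\<exists>M. \<forall>m\<ge>M. x \<bullet> (S i (r m) *v x) \<le> x \<bullet> (Y (r m) *v x) + \<epsilon> (r m) * (x \<bullet> x)"
          using S(2)[OF that] by (simp add: Z_def matrix_vector_mult_add_rdistrib inner_add_right
            scaleR_matrix_vector_assoc[symmetric])
      qed
      show "range ((*v) (A i)) \<subseteq> V i" if "i \<in> I" for i
      proof (intro image_subsetI)
        fix y
        have "(\<lambda>m. S i (r m) *v y) \<longlonglongrightarrow> A i *v y"
          using A[OF that] unfolding comp_def by (intro tendsto_intros)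
        then show "A i *v y \<in> V i"
        proof (rule closed_sequentially[OF closed_subspace[OF V[OF that]], rotated])
          show "S i (r m) *v y \<in> V i" for m using S(3)[OF that] by blast
        qed
      qed
      show "\<tau> * (\<Sum>i\<in>I. x \<bullet> (A i *v x)) = t' * (x \<bullet> (Y' *v x))" for x
      proof (rule LIMSEQ_unique)
        show "(\<lambda>m. t (r m) * (x \<bullet> (Y (r m) *v x))) \<longlonglongrightarrow> t' * (x \<bullet> (Y' *v x))"
          by (intro tendsto_mult t'_lim Yx)
        have "(\<lambda>m. \<tau> * (\<Sum>i\<in>I. x \<bullet> (S i (r m) *v x)) + \<epsilon> (r m) * (x \<bullet> x)) \<longlonglongrightarrow>
            \<tau> * (\<Sum>i\<in>I. x \<bullet> (A i *v x)) + 0 * (x \<bullet> x)"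
          using \<epsilon>r unfolding comp_def
          by (intro tendsto_add tendsto_mult tendsto_sum tendsto_const Sx)
        then show "(\<lambda>m. t (r m) * (x \<bullet> (Y (r m) *v x))) \<longlonglongrightarrow> \<tau> * (\<Sum>i\<in>I. x \<bullet> (A i *v x))"
          by (simp add: form)
      qed
    qed (use \<open>\<tau> \<ge> 0\<close> dim in auto)
    moreover have "2 \<le> t'" using t'_lim t by (intro LIMSEQ_le_const) auto
    ultimately show ?thesis by simp
  qed
qed

text \<open>With \<open>X\<close> the inverse of \<open>Z\<close>, the matrix
  \<open>shorted (P i) Z ** X\<close> is the \<open>X\<close>-orthogonal projection onto
  \<open>V i\<close>, and \<open>g i u\<close> is the squared \<open>X\<close>-length of the
  projection of \<open>u\<close>. The last property is Cauchy-Schwarz for the shorted operator,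
  which sends \<open>X *v v\<close> back to \<open>v\<close>.\<close>

lemma balanced_inner_product:
  fixes V :: "'i \<Rightarrow> (real^'n) set"
  assumes "finite I" and V: "\<And>i. i \<in> I \<Longrightarrow> subspace (V i)" and "\<tau> \<ge> 0"
    and dim: "\<And>W. subspace W \<Longrightarrow> \<tau> * (\<Sum>i\<in>I. real (dim (V i \<inter> W))) \<le> real (dim W)"
  obtains X :: "real^'n^'n" and g :: "'i \<Rightarrow> real^'n \<Rightarrow> real" where "posdef X"
    "\<And>i u. i \<in> I \<Longrightarrow> 0 \<le> g i u"
    "\<And>u. \<tau> * (\<Sum>i\<in>I. g i u) \<le> 2 * (u \<bullet> (X *v u))"
    "\<And>i u v. i \<in> I \<Longrightarrow> v \<in> V i \<Longrightarrow> (u \<bullet> (X *v v))\<^sup>2 \<le> g i u * (v \<bullet> (X *v v))"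
proof -
  have "\<forall>i\<in>I. \<exists>P. orth_proj P (V i)" using V orth_proj_exists by metis
  then obtain P where P: "\<And>i. i \<in> I \<Longrightarrow> orth_proj (P i) (V i)" by metis
  obtain Z where Z: "posdef Z"
    "\<And>x. \<tau> * (\<Sum>i\<in>I. x \<bullet> (shorted (P i) Z *v x)) \<le> 2 * (x \<bullet> (Z *v x))"
    using shorted_balanced[OF \<open>finite I\<close> P V \<open>\<tau> \<ge> 0\<close> dim] by blast
  define X where "X = matrix_inv Z"
  have ZX: "Z ** X = mat 1" and XZ: "X ** Z = mat 1"
    unfolding X_def using matrix_inv_inverse posdef_invertible[OF Z(1)] by auto
  have tX: "transpose X = X"
  proof -
    have "transpose X ** Z = mat 1"
      using ZX Z(1) by (metis matrix_transpose_mul posdef_def transpose_mat)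
    then show ?thesis by (metis ZX matrix_mul_assoc matrix_mul_lid matrix_mul_rid)
  qed
  have ZXu: "Z *v (X *v u) = u" for u by (simp add: matrix_vector_mul_assoc ZX)
  have symX: "u \<bullet> (X *v v) = (X *v u) \<bullet> v" for u v
    by (subst inner_matrix_vector_transpose) (simp only: tX)
  have "0 < x \<bullet> (X *v x)" if "x \<noteq> 0" for x
  proof -
    have "X *v x \<noteq> 0" using that ZXu[of x] by force
    then have "0 < (X *v x) \<bullet> (Z *v (X *v x))" using Z(1) by (simp add: posdef_def)
    then show ?thesis by (simp add: ZXu symX)
  qed
  then have X: "posdef X" using tX by (simp add: posdef_def)
  define g where "g i u = (X *v u) \<bullet> (shorted (P i) Z *v (X *v u))" for i u
  show ?thesis
  proof (rule that[OF X, of g])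
    show "0 \<le> g i u" if "i \<in> I" for i u
      unfolding g_def by (intro psd_nonneg shorted_properties(1)[OF P[OF that] Z(1)])
    show "\<tau> * (\<Sum>i\<in>I. g i u) \<le> 2 * (u \<bullet> (X *v u))" for u
      using Z(2)[of "X *v u"] by (simp add: g_def ZXu symX)
    show "(u \<bullet> (X *v v))\<^sup>2 \<le> g i u * (v \<bullet> (X *v v))" if "i \<in> I" "v \<in> V i" for i u v
    proof -
      have v: "shorted (P i) Z *v (X *v v) = v"
        by (rule shorted_properties(4)[OF P[OF that(1)] Z(1) that(2) ZX])
      show ?thesis
        using psd_Cauchy_Schwarz[OF shorted_properties(1)[OF P[OF that(1)] Z(1)], of "X *v u" "X *v v"]
        by (simp add: v g_def symX)
    qed
  qed
qed

section \<open>Counting pairs of close subspaces\<close>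

text \<open>All dimensions involved are bounded natural numbers, so the objective takes finitely
  many values and its maximum is attained.\<close>

lemma maximal_dense_subspace:
  fixes V :: "'i \<Rightarrow> 'a::euclidean_space set"
  assumes "finite I"
  obtains W where "subspace W" "\<And>W'. subspace W' \<Longrightarrow>
    \<tau> * (\<Sum>i\<in>I. real (dim (V i \<inter> W'))) - real (dim W') \<le>
    \<tau> * (\<Sum>i\<in>I. real (dim (V i \<inter> W))) - real (dim W)"
proof -
  define F where "F W = \<tau> * (\<Sum>i\<in>I. real (dim (V i \<inter> W))) - real (dim W)" for W
  have "F W \<in> (\<lambda>(a, b). \<tau> * real a - real b) ` ({..card I * DIM('a)} \<times> {..DIM('a)})" for W
  proof -
    have "(\<Sum>i\<in>I. dim (V i \<inter> W)) \<le> card I * DIM('a)"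
      using sum_bounded_above[of I "\<lambda>i. dim (V i \<inter> W)" "DIM('a)"]
      by (simp add: dim_subset_UNIV)
    moreover have "dim W \<le> DIM('a)" by (rule dim_subset_UNIV)
    ultimately show ?thesis
      by (intro image_eqI[of _ _ "(\<Sum>i\<in>I. dim (V i \<inter> W), dim W)"]) (auto simp: F_def)
  qed
  then have "F ` Collect subspace \<subseteq> (\<lambda>(a, b). \<tau> * real a - real b) ` ({..card I * DIM('a)} \<times> {..DIM('a)})"
    by blast
  then have fin: "finite (F ` Collect subspace)"
    by (rule finite_subset) auto
  have ne: "F ` Collect subspace \<noteq> {}" using subspace_UNIV by auto
  obtain W where W: "subspace W" "F W = Max (F ` Collect subspace)"
    using Max_in[OF fin ne] by auto
  have "F W' \<le> F W" if "subspace W'" for W'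
    using fin that W(2) by auto
  with W(1) that show ?thesis unfolding F_def by blast
qed

text \<open>In the inner product given by \<open>X\<close>, some angle between \<open>U\<close> and \<open>U'\<close> has cosine at least 1/3.\<close>

definition close :: "real^'n^'n \<Rightarrow> (real^'n) set \<Rightarrow> (real^'n) set \<Rightarrow> bool" where
  "close X U U' \<longleftrightarrow> (\<exists>u\<in>U. \<exists>v\<in>U'. u \<noteq> 0 \<and> v \<noteq> 0 \<and>
     (u \<bullet> (X *v u)) * (v \<bullet> (X *v v)) \<le> 9 * (u \<bullet> (X *v v))\<^sup>2)"

lemma not_closeD:
  assumes "\<not> close X U U'" "u \<in> U" "v \<in> U'"
  shows "9 * (u \<bullet> (X *v v))\<^sup>2 \<le> (u \<bullet> (X *v u)) * (v \<bullet> (X *v v))"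
  using assms unfolding close_def by (cases "u = 0"; cases "v = 0") force+

lemma close_refl:
  assumes "v \<in> U" "v \<noteq> 0"
  shows "close X U U"
  unfolding close_def using assms by (intro bexI[of _ v]) (auto simp: power2_eq_square)

text \<open>Write \<open>v = a + b\<close>. If no pair were close, the small correlations of
  \<open>v\<close> with \<open>a\<close> and \<open>b\<close> would force \<open>l\<close> to be at
  most 2/9 of \<open>A + B\<close>, while the small correlation of \<open>a\<close> with
  \<open>b\<close> would force it to be at least 2/3 of \<open>A + B\<close>.\<close>

lemma close_in_dependent_triple:
  assumes X: "posdef X" and v: "v \<in> U\<^sub>1" "v \<noteq> 0" and sub: "U\<^sub>1 \<subseteq> U\<^sub>2 + U\<^sub>3"
  shows "close X U\<^sub>1 U\<^sub>2 \<or> close X U\<^sub>1 U\<^sub>3 \<or> close X U\<^sub>2 U\<^sub>3"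
proof (rule ccontr)
  assume "\<not> ?thesis"
  then have not_close: "\<not> close X U\<^sub>1 U\<^sub>2" "\<not> close X U\<^sub>1 U\<^sub>3" "\<not> close X U\<^sub>2 U\<^sub>3" by auto
  have "v \<in> U\<^sub>2 + U\<^sub>3" using v(1) sub by blast
  then obtain a b where ab: "a \<in> U\<^sub>2" "b \<in> U\<^sub>3" "v = a + b"
    by (auto elim: set_plus_elim)
  have psd: "psd X" using X by (rule posdef_imp_psd)
  define l A B p q s where "l = v \<bullet> (X *v v)" and "A = a \<bullet> (X *v a)" and "B = b \<bullet> (X *v b)"
    and "p = v \<bullet> (X *v a)" and "q = v \<bullet> (X *v b)" and "s = a \<bullet> (X *v b)"
  have "l > 0" using X v(2) by (simp add: l_def posdef_def)
  have "A \<ge> 0" "B \<ge> 0" using psd_nonneg[OF psd] by (simp_all add: A_def B_def)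
  have bounds: "9 * p\<^sup>2 \<le> l * A" "9 * q\<^sup>2 \<le> l * B" "9 * s\<^sup>2 \<le> A * B"
    using not_closeD[OF not_close(1) v(1) ab(1)] not_closeD[OF not_close(2) v(1) ab(2)]
      not_closeD[OF not_close(3) ab(1,2)]
    by (simp_all add: l_def A_def B_def p_def q_def s_def)
  have l_pq: "l = p + q"
    by (simp add: l_def p_def q_def ab(3) algebra_simps inner_add_right matrix_vector_right_distrib)
  have l_AB: "l = A + B + 2 * s"
    using psd_symmetric[OF psd, of b a]
    by (simp add: l_def A_def B_def s_def ab(3) inner_add_left inner_add_right matrix_vector_right_distrib)
  have "9 * l\<^sup>2 \<le> 2 * (9 * p\<^sup>2 + 9 * q\<^sup>2)"
    using sum_squares_bound[of p q] by (simp add: l_pq power2_sum)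
  also have "\<dots> \<le> l * (2 * (A + B))" using bounds(1,2) by (simp add: algebra_simps)
  finally have "l * (9 * l) \<le> l * (2 * (A + B))" by (simp add: power2_eq_square algebra_simps)
  then have upper: "9 * l \<le> 2 * (A + B)" using \<open>l > 0\<close> by simp
  \<comment> \<open>By the inequality of arithmetic and geometric means,
    \<open>36 * s\<^sup>2 \<le> 4 * A * B \<le> (A + B)\<^sup>2\<close>.\<close>
  have "(6 * s)\<^sup>2 \<le> (A + B)\<^sup>2"
    using bounds(3) sum_squares_bound[of A B] by (simp add: power2_sum power_mult_distrib)
  then have "- (6 * s) \<le> A + B" using \<open>A \<ge> 0\<close> \<open>B \<ge> 0\<close>
    by (metis abs_le_D2 abs_le_square_iff abs_of_nonneg add_nonneg_nonneg)
  then have "2 * (A + B) \<le> 3 * l" using l_AB by simp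
  with upper \<open>l > 0\<close> show False by simp
qed

text \<open>The nonzero \<open>z\<close> makes a triple through \<open>i\<close> dependent in the
  sense of \<open>close_in_dependent_triple\<close>; the close pair found need not contain
  \<open>i\<close>. In a two-element set the spaces coincide and \<open>z\<close> itself witnesses
  closeness.\<close>

lemma ad_system_close_pair:
  assumes S: "ad_system \<alpha> \<delta> n V S" and X: "posdef X" and j: "j < length S"
    and i: "i \<in> S ! j" and z: "z \<in> V i" "z \<noteq> 0"
  shows "\<exists>i1 i2. i1 \<noteq> i2 \<and> {i1, i2} \<subseteq> S ! j \<and> close X (V i1) (V i2)"
proof -
  have "card (S ! j) = 3 \<or> card (S ! j) = 2" using S j by (simp add: ad_system_def)
  then show ?thesis
  proof
    assume "card (S ! j) = 3"
    then have "card (S ! j - {i}) = 2" using i by (simp add: card_Diff_singleton)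
    then obtain i2 i3 where "S ! j - {i} = {i2, i3}" "i2 \<noteq> i3" by (auto simp: card_2_iff)
    with i have eq: "S ! j = {i, i2, i3}" and d: "distinct [i, i2, i3]" by auto
    from S have "\<forall>j<length S. \<forall>i1 i2 i3. distinct [i1, i2, i3] \<and> S ! j = {i1, i2, i3} \<longrightarrow>
        V i1 \<subseteq> V i2 + V i3 \<and> V i2 \<subseteq> V i1 + V i3 \<and> V i3 \<subseteq> V i1 + V i2"
      unfolding ad_system_def by (elim conjE)
    with j eq d have "V i \<subseteq> V i2 + V i3" by presburger
    from close_in_dependent_triple[OF X z this] show ?thesis using eq d by auto
  next
    assume "card (S ! j) = 2"
    then have "card (S ! j - {i}) = 1" using i by (simp add: card_Diff_singleton)
    then obtain i2 where "S ! j - {i} = {i2}" by (auto simp: card_1_singleton_iff)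
    with i have eq: "S ! j = {i, i2}" and d: "i \<noteq> i2" by auto
    from S have "\<forall>j<length S. \<forall>i1 i2. i1 \<noteq> i2 \<and> S ! j = {i1, i2} \<longrightarrow> V i1 = V i2"
      unfolding ad_system_def by (elim conjE)
    with j eq d have "V i = V i2" by presburger
    then have "close X (V i) (V i2)" using close_refl[OF z, of X] by (simp only:)
    then show ?thesis using eq d by (intro exI[of _ i] exI[of _ i2]) simp
  qed
qed

text \<open>Sum \<open>g i\<close> over an \<open>X\<close>-orthonormal basis \<open>B\<close> of
  \<open>U\<close>. A close \<open>V i\<close> contributes at least 1/9, by expanding its witness
  \<open>u\<close> in \<open>B\<close> and applying Cauchy-Schwarz; for each basis vector the sum
  over \<open>i\<close>, times \<tau>, is at most 2. This gives 18 as 9 times 2.\<close>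

lemma card_close_le:
  fixes V :: "'i \<Rightarrow> (real^'n) set"
  assumes X: "posdef X" and U: "subspace U" and I: "finite I" and "\<tau> \<ge> 0"
    and g: "\<And>i u. i \<in> I \<Longrightarrow> 0 \<le> g i u"
      "\<And>u. \<tau> * (\<Sum>i\<in>I. g i u) \<le> 2 * (u \<bullet> (X *v u))"
      "\<And>i u v. i \<in> I \<Longrightarrow> v \<in> V i \<Longrightarrow> (u \<bullet> (X *v v))\<^sup>2 \<le> g i u * (v \<bullet> (X *v v))"
  shows "\<tau> * real (card {i \<in> I. close X U (V i)}) \<le> 18 * real (dim U)"
proof -
  have psd: "psd X" using X by (rule posdef_imp_psd)
  show ?thesis
  proof (rule psd_orthonormal_basis[OF psd U])
    fix B assume B: "finite B" "B \<subseteq> U" "card B \<le> dim U"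
      "\<And>b c. b \<in> B \<Longrightarrow> c \<in> B \<Longrightarrow> b \<bullet> (X *v c) = (if b = c then 1 else 0)"
      "\<And>x y. x \<in> U \<Longrightarrow> x \<bullet> (X *v y) = (\<Sum>b\<in>B. (x \<bullet> (X *v b)) * (b \<bullet> (X *v y)))"
    have close_ge: "1 \<le> 9 * (\<Sum>b\<in>B. g i b)" if "i \<in> I" "close X U (V i)" for i
    proof -
      obtain u v where uv: "u \<in> U" "v \<in> V i" "u \<noteq> 0" "v \<noteq> 0"
        "(u \<bullet> (X *v u)) * (v \<bullet> (X *v v)) \<le> 9 * (u \<bullet> (X *v v))\<^sup>2"
        using \<open>close X U (V i)\<close> by (auto simp: close_def)
      define l where "l = (u \<bullet> (X *v u)) * (v \<bullet> (X *v v))"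
      have "l > 0" using X uv(3,4) by (simp add: l_def posdef_def)
      \<comment> \<open>Parseval's identity for the form \<open>X\<close> on
        \<open>U\<close>.\<close>
      have uu: "(\<Sum>b\<in>B. (u \<bullet> (X *v b))\<^sup>2) = u \<bullet> (X *v u)"
        unfolding B(5)[OF uv(1), of u] power2_eq_square
        by (intro sum.cong refl) (metis psd_symmetric[OF psd])
      have "(u \<bullet> (X *v v))\<^sup>2 = (\<Sum>b\<in>B. (u \<bullet> (X *v b)) * (b \<bullet> (X *v v)))\<^sup>2"
        by (subst B(5)[OF uv(1)]) simp
      also have "\<dots> \<le> (\<Sum>b\<in>B. (u \<bullet> (X *v b))\<^sup>2) * (\<Sum>b\<in>B. (b \<bullet> (X *v v))\<^sup>2)"
        by (rule Cauchy_Schwarz_ineq_sum)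
      also have "\<dots> \<le> (u \<bullet> (X *v u)) * (\<Sum>b\<in>B. g i b * (v \<bullet> (X *v v)))"
        unfolding uu using g(3)[OF that(1) uv(2)] psd_nonneg[OF psd]
        by (intro mult_left_mono sum_mono) auto
      also have "\<dots> = l * (\<Sum>b\<in>B. g i b)"
        by (simp add: l_def sum_distrib_right sum_distrib_left mult_ac)
      finally have "l * 1 \<le> l * (9 * (\<Sum>b\<in>B. g i b))" using uv(5) by (simp add: l_def)
      then show ?thesis using \<open>l > 0\<close> by simp
    qed
    have "\<tau> * real (card {i \<in> I. close X U (V i)}) = \<tau> * (\<Sum>i\<in>{i \<in> I. close X U (V i)}. 1)"
      by simp
    also have "\<dots> \<le> \<tau> * (\<Sum>i\<in>{i \<in> I. close X U (V i)}. 9 * (\<Sum>b\<in>B. g i b))"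
      using close_ge \<open>\<tau> \<ge> 0\<close> by (intro mult_left_mono sum_mono) auto
    also have "\<dots> \<le> \<tau> * (\<Sum>i\<in>I. 9 * (\<Sum>b\<in>B. g i b))"
      using I g(1) \<open>\<tau> \<ge> 0\<close> by (intro mult_left_mono sum_mono2) (auto intro: sum_nonneg)
    also have "\<dots> = 9 * (\<Sum>b\<in>B. \<tau> * (\<Sum>i\<in>I. g i b))"
    proof -
      have "\<tau> * (\<Sum>i\<in>I. 9 * (\<Sum>b\<in>B. g i b)) = (\<Sum>i\<in>I. \<Sum>b\<in>B. 9 * (\<tau> * g i b))"
        by (simp add: sum_distrib_left sum_distrib_right mult_ac)
      also have "\<dots> = (\<Sum>b\<in>B. \<Sum>i\<in>I. 9 * (\<tau> * g i b))" by (rule sum.swap)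
      finally show ?thesis by (simp add: sum_distrib_left)
    qed
    also have "\<dots> \<le> 9 * (\<Sum>b\<in>B. 2 * (b \<bullet> (X *v b)))"
      using g(2) by (intro mult_left_mono sum_mono) auto
    also have "\<dots> = 18 * real (card B)" using B(4) by simp
    finally show ?thesis using B(3) by simp
  qed
qed

text \<open>Incidences between \<open>N\<close> and the positions \<open>T\<close> of sets meeting
  it are counted twice. Each index of \<open>N\<close> gives at least \<delta> n of them, each set
  at most 3. Each such set contains a related pair inside \<open>N\<close>, and a pair lies in at
  most \<alpha> sets. Pairs meeting \<open>B\<close> number at most \<open>card B * card N\<close>,
  the others at most \<open>card N * K\<close>. In the application \<open>c\<close> is closeness,
  \<open>N\<close> indexes the nonzero spaces and \<open>B\<close> the few discarded ones.\<close>

lemma ad_system_double_counting: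
  fixes K :: real
  assumes S: "ad_system \<alpha> \<delta> n V S" and N: "N \<subseteq> {1..n}" and B: "B \<subseteq> {1..n}"
    and pair: "\<And>j. j < length S \<Longrightarrow> S ! j \<inter> N \<noteq> {} \<Longrightarrow>
      \<exists>i1 i2. i1 \<noteq> i2 \<and> {i1, i2} \<subseteq> S ! j \<inter> N \<and> c i1 i2"
    and K: "\<And>i. i \<in> N - B \<Longrightarrow> real (card {i' \<in> N - B. c i i'}) \<le> K"
    and "K \<ge> 0"
  shows "real (card N) * (\<delta> * real n) \<le> 3 * real \<alpha> * real (card N) * (real (card B) + K)"
proof -
  define T where "T = {j. j < length S \<and> S ! j \<inter> N \<noteq> {}}"
  define D where "D i i' = {j. j < length S \<and> {i, i'} \<subseteq> S ! j}" for i i'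
  have fin: "finite N" "finite B" "finite T"
    using N B by (auto simp: T_def intro: finite_subset)
  have D: "card (D i i') \<le> \<alpha>" if "i \<in> {1..n}" "i' \<in> {1..n}" "i \<noteq> i'" for i i'
    using S that by (simp add: ad_system_def D_def)
  have finD: "finite (D i i')" for i i' by (simp add: D_def)
  define PB where "PB = {(i, i'). i \<in> B \<and> i' \<in> N \<and> i \<noteq> i'}"
  define PG where "PG = {(i, i'). i \<in> N - B \<and> i' \<in> N - B \<and> i \<noteq> i' \<and> c i i'}"
  have finP: "finite PB" "finite PG"
    using fin finite_subset[of PB "B \<times> N"] finite_subset[of PG "N \<times> N"]
    by (auto simp: PB_def PG_def)
  have cardPB: "card PB \<le> card B * card N"
    using card_mono[of "B \<times> N" PB] fin by (auto simp: PB_def card_cartesian_product)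
  have cardPG: "real (card PG) \<le> real (card N) * K"
  proof -
    have "PG \<subseteq> Sigma (N - B) (\<lambda>i. {i' \<in> N - B. c i i'})" by (auto simp: PG_def)
    then have "card PG \<le> card (Sigma (N - B) (\<lambda>i. {i' \<in> N - B. c i i'}))"
      using fin by (intro card_mono) auto
    also have "\<dots> = (\<Sum>i\<in>N - B. card {i' \<in> N - B. c i i'})" using fin by simp
    finally have "real (card PG) \<le> real (\<Sum>i\<in>N - B. card {i' \<in> N - B. c i i'})"
      by (rule of_nat_mono)
    also have "\<dots> = (\<Sum>i\<in>N - B. real (card {i' \<in> N - B. c i i'}))" by (rule of_nat_sum)
    also have "\<dots> \<le> (\<Sum>i\<in>N - B. K)" using K by (rule sum_mono)
    also have "\<dots> = real (card (N - B)) * K" by simp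
    also have "\<dots> \<le> real (card N) * K"
      using fin \<open>K \<ge> 0\<close> by (intro mult_right_mono) (auto intro: card_mono)
    finally show ?thesis .
  qed
  have "T \<subseteq> (\<Union>(i, i')\<in>PB \<union> PG. D i i')"
  proof
    fix j assume "j \<in> T"
    then have j: "j < length S" "S ! j \<inter> N \<noteq> {}" by (auto simp: T_def)
    then obtain i1 i2 where i: "i1 \<noteq> i2" "{i1, i2} \<subseteq> S ! j \<inter> N" "c i1 i2" using pair by blast
    show "j \<in> (\<Union>(i, i')\<in>PB \<union> PG. D i i')"
    proof (cases "i1 \<in> B \<or> i2 \<in> B")
      case True
      \<comment> \<open>\<open>c\<close> need not be symmetric, but \<open>PB\<close> does not
        involve \<open>c\<close>, so the pair may be swapped to put an element of \<open>B\<close>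
        first.\<close>
      then have "(i1, i2) \<in> PB \<or> (i2, i1) \<in> PB" using i by (auto simp: PB_def)
      moreover have "j \<in> D i1 i2" "j \<in> D i2 i1" using i j by (auto simp: D_def)
      ultimately show ?thesis by blast
    next
      case False
      then have "(i1, i2) \<in> PG" using i by (auto simp: PG_def)
      moreover have "j \<in> D i1 i2" using i j by (auto simp: D_def)
      ultimately show ?thesis by blast
    qed
  qed
  then have "card T \<le> card (\<Union>(i, i')\<in>PB \<union> PG. D i i')"
    using finP finD by (intro card_mono) auto
  also have "\<dots> \<le> (\<Sum>(i, i')\<in>PB \<union> PG. card (D i i'))"
    using card_UN_le[of "PB \<union> PG" "\<lambda>(i, i'). D i i'"] finP by (simp add: case_prod_unfold)
  also have "\<dots> \<le> (\<Sum>(i, i')\<in>PB \<union> PG. \<alpha>)"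
    using N B by (intro sum_mono) (auto simp: PB_def PG_def intro!: D)
  also have "\<dots> = card (PB \<union> PG) * \<alpha>" by simp
  also have "\<dots> \<le> (card PB + card PG) * \<alpha>" by (intro mult_right_mono card_Un_le) auto
  finally have "real (card T) \<le> real ((card PB + card PG) * \<alpha>)" by (rule of_nat_mono)
  also have "\<dots> = (real (card PB) + real (card PG)) * real \<alpha>" by simp
  also have "\<dots> \<le> (real (card B * card N) + real (card N) * K) * real \<alpha>"
    using cardPB cardPG by (intro mult_right_mono add_mono of_nat_mono) auto
  finally have T_le: "real (card T) \<le> real \<alpha> * real (card N) * (real (card B) + K)"
    by (simp add: algebra_simps)
  have "real (card N) * (\<delta> * real n) = (\<Sum>i\<in>N. \<delta> * real n)" by simp
  also have "\<dots> \<le> (\<Sum>i\<in>N. real (card {j. j < length S \<and> i \<in> S ! j}))"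
    using S N by (intro sum_mono) (auto simp: ad_system_def)
  also have "\<dots> = real (\<Sum>i\<in>N. \<Sum>j\<in>T. if i \<in> S ! j then 1 else 0)"
  proof -
    have "card {j. j < length S \<and> i \<in> S ! j} = (\<Sum>j\<in>T. if i \<in> S ! j then 1 else 0)" if "i \<in> N" for i
    proof -
      have "{j. j < length S \<and> i \<in> S ! j} = {j \<in> T. i \<in> S ! j}" using that by (auto simp: T_def)
      then show ?thesis using fin(3) by (simp add: sum.If_cases Int_def)
    qed
    then show ?thesis by simp
  qed
  also have "\<dots> = real (\<Sum>j\<in>T. \<Sum>i\<in>N. if i \<in> S ! j then 1 else 0)" by (subst sum.swap) simp
  also have "\<dots> \<le> real (\<Sum>j\<in>T. 3)"
  proof (intro of_nat_mono sum_mono)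
    fix j assume "j \<in> T"
    then have "card (S ! j) = 3 \<or> card (S ! j) = 2" "S ! j \<subseteq> {1..n}"
      using S by (auto simp: T_def ad_system_def)
    then have "card (N \<inter> S ! j) \<le> 3"
      by (metis card_mono finite_atLeastAtMost finite_subset inf_le2 le_trans numeral_le_iff
          order_refl semiring_norm(72))
    then show "(\<Sum>i\<in>N. if i \<in> S ! j then 1 else 0) \<le> (3::nat)"
      using fin(1) by (simp add: sum.If_cases Int_def)
  qed
  finally show ?thesis using T_le by simp
qed

section \<open>The dichotomy and the theorem\<close>

text \<open>\<open>D\<close> stands for \<beta> d. The vector \<open>z\<^sub>0\<close> excludes the
  degenerate case of zero spaces only, and makes \<open>n\<close>, \<open>k\<close> and later
  \<open>card N\<close> positive.\<close>

lemma dim_le_or_dense_subspace: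
  fixes V :: "nat \<Rightarrow> (real^'n) set"
  assumes V: "\<And>i. i \<in> {1..n} \<Longrightarrow> subspace (V i)" "\<And>i. i \<in> {1..n} \<Longrightarrow> dim (V i) \<le> k"
    and S: "ad_system \<alpha> \<delta> n V S" and pos: "\<alpha> > 0" "\<delta> > 0" "D > 0"
    and nonzero: "i\<^sub>0 \<in> {1..n}" "z\<^sub>0 \<in> V i\<^sub>0" "z\<^sub>0 \<noteq> 0"
  obtains W where "subspace W" "real (dim W) \<le> D"
      "\<delta> * real n / (20 * real \<alpha>) \<le> real (card {i \<in> {1..n}. \<exists>z \<in> V i \<inter> W. z \<noteq> 0})"
    | "D \<le> 400 * real \<alpha> * real k ^ 3 / \<delta>"
proof -
  have "n > 0" using nonzero(1) by simp
  have "k > 0"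
  proof (rule ccontr)
    assume "\<not> k > 0"
    then have "V i\<^sub>0 \<subseteq> {0}" using V(2)[OF nonzero(1)] by (simp add: dim_eq_0)
    with nonzero show False by auto
  qed
  \<comment> \<open>The dimensions of the \<open>V i \<inter> W\<close> sum to at most
    \<open>n * k\<close>, so with this \<tau> comparing the maximiser \<open>W\<close> with the zero
    subspace yields \<open>dim W \<le> D\<close>.\<close>
  define \<tau> where "\<tau> = D / (real n * real k)"
  have "\<tau> > 0" using \<open>n > 0\<close> \<open>k > 0\<close> pos by (simp add: \<tau>_def)
  obtain W where W: "subspace W" and max: "\<And>W'. subspace W' \<Longrightarrow>
    \<tau> * (\<Sum>i\<in>{1..n}. real (dim (V i \<inter> W'))) - real (dim W') \<le>
    \<tau> * (\<Sum>i\<in>{1..n}. real (dim (V i \<inter> W))) - real (dim W)"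
    using maximal_dense_subspace[of "{1..n}" \<tau> V] by auto
  define B where "B = {i \<in> {1..n}. \<exists>z \<in> V i \<inter> W. z \<noteq> 0}"
  have "real (dim W) \<le> \<tau> * (\<Sum>i\<in>{1..n}. real (dim (V i \<inter> W)))"
  proof -
    have "real (dim (V i \<inter> {0})) = 0" for i by simp
    then show ?thesis using max[of "{0}"] by (simp del: of_nat_eq_0_iff)
  qed
  also have "\<dots> \<le> \<tau> * (\<Sum>i\<in>{1..n}. real k)"
  proof (intro mult_left_mono sum_mono of_nat_mono)
    fix i assume "i \<in> {1..n}"
    then show "dim (V i \<inter> W) \<le> k" using V(2)[of i] dim_subset[of "V i \<inter> W" "V i"] by auto
  qed (use \<open>\<tau> > 0\<close> in auto)
  also have "\<dots> = D" using \<open>n > 0\<close> \<open>k > 0\<close> by (simp add: \<tau>_def)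
  finally have dimW: "real (dim W) \<le> D" .
  show ?thesis
  proof (cases "\<delta> * real n / (20 * real \<alpha>) \<le> real (card B)")
    case True
    then show ?thesis using that(1)[OF W dimW] by (simp add: B_def)
  next
    case False
    define G where "G = {1..n} - B"
    \<comment> \<open>Compare \<open>W\<close> with \<open>U = W' + W\<close> by maximality. For
      \<open>i\<close> in \<open>G\<close> the space \<open>V i \<inter> W\<close> is zero while
      \<open>V i \<inter> U\<close> contains \<open>V i \<inter> W'\<close>; for \<open>i\<close> in
      \<open>B\<close>, \<open>V i \<inter> U\<close> contains \<open>V i \<inter> W\<close>. The
      contributions of \<open>B\<close> cancel, and \<open>U\<close> exceeds \<open>W\<close> in
      dimension by at most \<open>dim W'\<close>.\<close>
    have Gdim: "\<tau> * (\<Sum>i\<in>G. real (dim (V i \<inter> W'))) \<le> real (dim W')" if W': "subspace W'" for W'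
    proof -
      define U where "U = {x + y |x y. x \<in> W' \<and> y \<in> W}"
      have U: "subspace U" unfolding U_def using W' W by (rule subspace_sums)
      have sub: "W' \<subseteq> U" "W \<subseteq> U"
        using subspace_0[OF W] subspace_0[OF W'] unfolding U_def by force+
      have dimU: "dim U \<le> dim W' + dim W"
        unfolding U_def using dim_sums_Int[OF W' W] by simp
      have split: "(\<Sum>i\<in>{1..n}. h i) = (\<Sum>i\<in>G. h i) + (\<Sum>i\<in>B. h i)" for h :: "nat \<Rightarrow> real"
        unfolding G_def by (rule sum.subset_diff) (auto simp: B_def)
      have G0: "(\<Sum>i\<in>G. real (dim (V i \<inter> W))) = 0"
        by (intro sum.neutral) (auto simp: G_def B_def)
      have "(\<Sum>i\<in>G. real (dim (V i \<inter> W'))) + (\<Sum>i\<in>B. real (dim (V i \<inter> W)))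
          \<le> (\<Sum>i\<in>{1..n}. real (dim (V i \<inter> U)))"
        unfolding split using sub
        by (intro add_mono sum_mono of_nat_mono dim_subset) auto
      then have "\<tau> * ((\<Sum>i\<in>G. real (dim (V i \<inter> W'))) + (\<Sum>i\<in>B. real (dim (V i \<inter> W))))
          \<le> \<tau> * (\<Sum>i\<in>{1..n}. real (dim (V i \<inter> U)))"
        using \<open>\<tau> > 0\<close> by (intro mult_left_mono) auto
      moreover have "(\<Sum>i\<in>{1..n}. real (dim (V i \<inter> W))) = (\<Sum>i\<in>B. real (dim (V i \<inter> W)))"
        unfolding split using G0 by simp
      ultimately show ?thesis using max[OF U] dimU by (simp add: distrib_left)
    qed
    have finG: "finite G" by (simp add: G_def)
    have VG: "\<And>i. i \<in> G \<Longrightarrow> subspace (V i)" using V(1) by (auto simp: G_def)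
    have "D \<le> 400 * real \<alpha> * real k ^ 3 / \<delta>"
    proof (rule balanced_inner_product[OF finG VG less_imp_le[OF \<open>\<tau> > 0\<close>] Gdim])
      fix X :: "real^'n^'n" and g :: "nat \<Rightarrow> real^'n \<Rightarrow> real"
      assume X: "posdef X" and g: "\<And>i u. i \<in> G \<Longrightarrow> 0 \<le> g i u"
        "\<And>u. \<tau> * (\<Sum>i\<in>G. g i u) \<le> 2 * (u \<bullet> (X *v u))"
        "\<And>i u v. i \<in> G \<Longrightarrow> v \<in> V i \<Longrightarrow> (u \<bullet> (X *v v))\<^sup>2 \<le> g i u * (v \<bullet> (X *v v))"
      \<comment> \<open>Zero spaces are left out because a set of the system made only of them
        contains no close pair.\<close>
      define N where "N = {i \<in> {1..n}. \<exists>z\<in>V i. z \<noteq> 0}"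
      have "card N > 0" using nonzero by (auto simp: N_def card_gt_0_iff)
      have "real (card N) * (\<delta> * real n) \<le>
          3 * real \<alpha> * real (card N) * (real (card B) + 18 * real k / \<tau>)"
      proof (rule ad_system_double_counting[OF S, where c = "\<lambda>i i'. close X (V i) (V i')"])
        show "N \<subseteq> {1..n}" "B \<subseteq> {1..n}" by (auto simp: N_def B_def)
        show "0 \<le> 18 * real k / \<tau>" using \<open>\<tau> > 0\<close> by simp
        show "\<exists>i1 i2. i1 \<noteq> i2 \<and> {i1, i2} \<subseteq> S ! j \<inter> N \<and> close X (V i1) (V i2)"
          if j: "j < length S" "S ! j \<inter> N \<noteq> {}" for j
        proof -
          obtain i z where i: "i \<in> S ! j" "z \<in> V i" "z \<noteq> 0" using j(2) by (auto simp: N_def)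
          obtain i1 i2 where c: "i1 \<noteq> i2" "{i1, i2} \<subseteq> S ! j" "close X (V i1) (V i2)"
            using ad_system_close_pair[OF S X j(1) i] by auto
          have "S ! j \<subseteq> {1..n}" using S j(1) by (simp add: ad_system_def)
          then have "{i1, i2} \<subseteq> N" using c(2,3) by (auto simp: N_def close_def)
          with c show ?thesis by (intro exI[of _ i1] exI[of _ i2]) simp
        qed
        show "real (card {i' \<in> N - B. close X (V i) (V i')}) \<le> 18 * real k / \<tau>"
          if "i \<in> N - B" for i
        proof -
          have i: "i \<in> {1..n}" using that by (simp add: N_def)
          have "card {i' \<in> N - B. close X (V i) (V i')} \<le> card {i' \<in> G. close X (V i) (V i')}"
            using finG by (intro card_mono) (auto simp: N_def G_def)
          then have "\<tau> * real (card {i' \<in> N - B. close X (V i) (V i')}) \<le>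
              \<tau> * real (card {i' \<in> G. close X (V i) (V i')})"
            using \<open>\<tau> > 0\<close> by (intro mult_left_mono) auto
          also have "\<dots> \<le> 18 * real (dim (V i))"
            using card_close_le[OF X V(1)[OF i] finG less_imp_le[OF \<open>\<tau> > 0\<close>] g] .
          also have "\<dots> \<le> 18 * real k" using V(2)[OF i] by simp
          finally show ?thesis using \<open>\<tau> > 0\<close> by (simp add: field_simps)
        qed
      qed
      then have "real (card N) * (\<delta> * real n) \<le>
          real (card N) * (3 * real \<alpha> * (real (card B) + 18 * real k / \<tau>))"
        by (simp add: mult_ac)
      then have "\<delta> * real n \<le> 3 * real \<alpha> * (real (card B) + 18 * real k / \<tau>)"
        using \<open>card N > 0\<close> by simp
      \<comment> \<open>The bound on \<open>card B\<close> costs 3/20 of the left side and leaves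
        17/20. Inserting \<tau> then gives
        \<open>D \<le> (1080 / 17) * \<alpha> * k\<^sup>2 / \<delta>\<close>, which is within the
        claimed bound as \<open>k \<ge> 1\<close> and 1080/17 is below 400.\<close>
      also have "\<dots> \<le> 3 * real \<alpha> * (\<delta> * real n / (20 * real \<alpha>) + 18 * real k / \<tau>)"
        using False by (intro mult_left_mono add_mono) auto
      also have "\<dots> = 3 / 20 * (\<delta> * real n) + 54 * real \<alpha> * real k / \<tau>"
        using pos by (simp add: field_simps)
      finally have "17 * (\<delta> * real n) \<le> 1080 * real \<alpha> * real k / \<tau>" by simp
      also have "\<dots> = (1080 * real \<alpha> * (real k)\<^sup>2 / D) * real n"
        using \<open>n > 0\<close> pos by (simp add: \<tau>_def field_simps power2_eq_square)
      finally have "(17 * \<delta>) * real n \<le> (1080 * real \<alpha> * (real k)\<^sup>2 / D) * real n"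
        by (simp only: mult.assoc)
      then have "17 * \<delta> \<le> 1080 * real \<alpha> * (real k)\<^sup>2 / D"
        by (rule mult_right_le_imp_le) (use \<open>n > 0\<close> in simp)
      then have "17 * (D * \<delta>) \<le> 1080 * (real \<alpha> * (real k)\<^sup>2)"
        using pos by (simp add: field_simps)
      moreover have "real \<alpha> * (real k)\<^sup>2 \<le> real \<alpha> * real k ^ 3"
        using \<open>k > 0\<close> by (intro mult_left_mono power_increasing) auto
      moreover have "0 \<le> real \<alpha> * real k ^ 3" by simp
      ultimately have "D * \<delta> \<le> 400 * (real \<alpha> * real k ^ 3)" by linarith
      then show ?thesis using pos by (simp add: field_simps)
    qed
    then show ?thesis by (rule that(2))
  qed
qed

theorem theorem23:
  fixes V :: "nat \<Rightarrow> (real ^ 'l) set"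
    and n k \<alpha> d :: nat and \<delta> \<beta> :: real
  assumes "\<And>i. i \<in> {1..n} \<Longrightarrow> subspace (V i)"
    and "\<And>i. i \<in> {1..n} \<Longrightarrow> dim (V i) \<le> k"
    and "\<alpha> > 0" and "\<delta> > 0"
    and "\<exists>S. ad_system \<alpha> \<delta> n V S"
    and "d = dim (\<Sum>i\<in>{1..n}. V i)"
    and "0 < \<beta>" and "\<beta> < 1"
  shows "real d \<le> 400 * real \<alpha> * real k ^ 3 / (\<beta> * \<delta>) \<or>
    (\<exists>(q::nat) (ix :: nat \<Rightarrow> nat) (z :: nat \<Rightarrow> real ^ 'l).
       real q \<ge> \<delta> * real n / (20 * real \<alpha>) \<and>
       inj_on ix {1..q} \<and> ix ` {1..q} \<subseteq> {1..n} \<and>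
       (\<forall>t\<in>{1..q}. z t \<in> V (ix t) \<and> z t \<noteq> 0) \<and>
       real (dim (span (z ` {1..q}))) \<le> \<beta> * real d)"
proof (cases "d = 0")
  case True
  then show ?thesis using assms(3,4,7) by (intro disjI1) simp
next
  case False
  obtain S where S: "ad_system \<alpha> \<delta> n V S" using assms(5) by blast
  have "\<exists>i\<in>{1..n}. \<exists>z\<in>V i. z \<noteq> 0"
  proof (rule ccontr)
    assume "\<not> ?thesis"
    \<comment> \<open>Here \<open>0\<close> is the neutral element of set addition, the set
      \<open>{0}\<close>.\<close>
    then have "V i = 0" if "i \<in> {1..n}" for i
      unfolding set_zero using subspace_0[OF assms(1)[OF that]] that by blast
    then have "(\<Sum>i\<in>{1..n}. V i) = 0" by (intro sum.neutral) blast
    then have "d = 0" using assms(6) by (simp add: set_zero)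
    with False show False ..
  qed
  then obtain i\<^sub>0 z\<^sub>0 where nonzero: "i\<^sub>0 \<in> {1..n}" "z\<^sub>0 \<in> V i\<^sub>0" "z\<^sub>0 \<noteq> 0" by blast
  have pos: "\<beta> * real d > 0" using False assms(7) by simp
  show ?thesis
  proof (rule dim_le_or_dense_subspace[OF assms(1,2) S assms(3,4) pos nonzero])
    fix W assume W: "subspace W" "real (dim W) \<le> \<beta> * real d"
      "\<delta> * real n / (20 * real \<alpha>) \<le> real (card {i \<in> {1..n}. \<exists>z\<in>V i \<inter> W. z \<noteq> 0})"
    define B where "B = {i \<in> {1..n}. \<exists>z\<in>V i \<inter> W. z \<noteq> 0}"
    \<comment> \<open>The number \<open>q\<close> is \<open>card B\<close>, and \<open>ix\<close>
      enumerates \<open>B\<close>. All \<open>z t\<close> are chosen inside \<open>W\<close>, so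
      their span has dimension at most \<open>dim W\<close>.\<close>
    obtain ix where ix: "bij_betw ix {1..card B} B"
      using ex_bij_betw_nat_finite_1[of B] by (auto simp: B_def)
    have "\<forall>t\<in>{1..card B}. \<exists>z. z \<in> V (ix t) \<and> z \<in> W \<and> z \<noteq> 0"
      using bij_betwE[OF ix] by (auto simp: B_def)
    then obtain z where z: "\<And>t. t \<in> {1..card B} \<Longrightarrow> z t \<in> V (ix t) \<and> z t \<in> W \<and> z t \<noteq> 0"
      by metis
    have "dim (z ` {1..card B}) \<le> dim W" using z by (intro dim_subset) auto
    then have "real (dim (span (z ` {1..card B}))) \<le> \<beta> * real d" using W(2) by simp
    moreover have "inj_on ix {1..card B}" "ix ` {1..card B} \<subseteq> {1..n}"
      using ix by (auto simp: bij_betw_def B_def)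
    ultimately show ?thesis using W(3) z unfolding B_def[symmetric] by blast
  next
    assume "\<beta> * real d \<le> 400 * real \<alpha> * real k ^ 3 / \<delta>"
    then show ?thesis using assms(4,7) by (intro disjI1) (simp add: field_simps)
  qed
qed

end
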